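(* Let $\mathcal H=\mathrm{Forb}(\mathcal F)$ be a non-trivial hereditary property, where $\mathcal F$ is a non-empty family of graphs, and set $\chi=\chi(\mathcal F)$. For $p\in(0,1/2)$, define $$q_{\mathcal H}(p)=\min\bigl\{g_K(p):|VW(K)|=\chi-1,\ K\in\mathcal K_0(\mathcal H)\bigr\}.$$ Then $p=0$ is a regular point of $\mathcal H$ if and only if $$\mathrm{ed}_{\mathcal H}(p)=q_{\mathcal H}(p)\qquad\text{for all sufficiently small } p>0.$$
   Context: All graphs are finite and simple. For a family $\mathcal F$ of graphs, $\mathrm{Forb}(\mathcal F)$ is the family of all graphs containing no member of $\mathcal F$ as an induced subgraph, and $\chi(\mathcal F)=\min\{\chi(F):F\in\mathcal F\}$, where $\chi(F)$ is the chromatic number. A hereditary property is a family of graphs closed under isomorphism and vertex-deletion (each is of the form $\mathrm{Forb}(\mathcal F)$); it is non-trivial if it contains graphs of unbounded order (and then it contains graphs of every order). Edit distance function. For graphs $G,H$ on the same vertex set $V$, $\mathrm{dist}(G,H)=|E(G)\triangle E(H)|/\binom{|V|}{2}$. For a non-trivial hereditary property $\mathcal H$, $\mathrm{dist}(G,\mathcal H)=\min\{\mathrm{dist}(G,H):H\in\mathcal H,\ V(H)=V(G)\}$, and $$\mathrm{ed}_{\mathcal H}(p)=\limsup_{n\to\infty}\max\Bigl\{\mathrm{dist}(G,\mathcal H):|V(G)|=n,\ |E(G)|=\Bigl\lfloor p\tbinom n2\Bigr\rfloor\Bigr\},\qquad p\in[0,1].$$ CRGs. A colored regularity graph (CRG)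 $K$ is a finite non-empty clique together with a partition of its vertices into black and white, $V(K)=VB(K)\sqcup VW(K)$, and a partition of its edges into black, white and gray, $E(K)=EB(K)\sqcup EW(K)\sqcup EG(K)$. For a graph $F$, write $F\mapsto K$ if there is a function $\phi\colon V(F)\to V(K)$ such that: for every $uv\in E(F)$, either $\phi(u)=\phi(v)\in VB(K)$ or $\phi(u)\phi(v)\in EB(K)\cup EG(K)$; and for every pair of distinct $u,v$ with $uv\notin E(F)$, either $\phi(u)=\phi(v)\in VW(K)$ or $\phi(u)\phi(v)\in EW(K)\cup EG(K)$. Write $\mathcal F\mapsto K$ if $F\mapsto K$ for some $F\in\mathcal F$, and $\mathcal F\not\mapsto K$ otherwise. $\mathcal K(\mathcal H)$ is the set of all CRGs $K$ with $\mathcal F\not\mapsto K$. For $p\in[0,1]$, $M_K(p)\in\mathbb R^{V(K)\times V(K)}$ is the matrix whose $(x,y)$ entry is $p$ if $x=y\in VW(K)$ or $xy\in EW(K)$; $1-p$ if $x=y\in VB(K)$ or $xy\in EB(K)$; and $0$ if $xy\in EG(K)$. Set $g_K(p)=\min\{\langle\mu,M_K(p)\mu\rangle:\mu\in\Delta^K\}$, where $\Delta^K$ is the set of all probability masses on $V(K)$. A CRG $K$ is $0$-core if it has only white and gray edges and $EW(K)\subseteq\binom{VB(K)}{2}$ (every white edge joins two black vertices). $\mathcal K_0(\mathcal H)$ is the set of all $0$-core CRGs in $\mathcal K(\mathcal H)$. A point $p_0\in[0,1]$ is a regular point of $\mathcal H$ if there are $\epsilon>0$ and a finite subset $\mathcal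 K'\subseteq\mathcal K(\mathcal H)$ such that $\mathrm{ed}_{\mathcal H}(p)=\min_{K\in\mathcal K'}g_K(p)$ for every $p\in(p_0-\epsilon,p_0+\epsilon)\cap[0,1]$. *)

theory Defs
  imports "HOL-Analysis.Analysis" "HOL-Library.Ramsey"
begin

section \<open>Finite simple graphs and hereditary properties\<close>

record 'a graph =
  verts :: "'a set"
  edges :: "'a set set"

definition is_graph :: "'a graph \<Rightarrow> bool" where
  "is_graph G \<longleftrightarrow> finite (verts G) \<and> edges G \<subseteq> [verts G]\<^bsup>2\<^esup>"

text \<open>\<open>G\<close> contains a copy of \<open>F\<close> as an induced subgraph, that is, some induced subgraph of \<open>G\<close> is
  isomorphic to \<open>F\<close>.\<close>

definition contains_induced :: "'a graph \<Rightarrow> 'b graph \<Rightarrow> bool" where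
  "contains_induced G F \<longleftrightarrow>
     (\<exists>f. inj_on f (verts F) \<and> f ` verts F \<subseteq> verts G \<and>
          (\<forall>u\<in>verts F. \<forall>v\<in>verts F. {u, v} \<in> edges F \<longleftrightarrow> {f u, f v} \<in> edges G))"

text \<open>Every finite graph is isomorphic to one whose vertices are natural numbers, so families of graphs
  are represented by sets of graphs on \<open>nat\<close>; \<open>Forb \<F>\<close> is closed under isomorphism between such
  graphs.\<close>

definition Forb :: "nat graph set \<Rightarrow> nat graph set" where
  "Forb \<F> = {G. is_graph G \<and> (\<forall>F\<in>\<F>. \<not> contains_induced G F)}"

definition nontrivial_property :: "nat graph set \<Rightarrow> bool" where
  "nontrivial_property \<H> \<longleftrightarrow> (\<forall>n. \<exists>G\<in>\<H>. n \<le> card (verts G))"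

definition proper_colouring :: "'a graph \<Rightarrow> nat \<Rightarrow> ('a \<Rightarrow> nat) \<Rightarrow> bool" where
  "proper_colouring G k c \<longleftrightarrow>
     c ` verts G \<subseteq> {..<k} \<and>
     (\<forall>u\<in>verts G. \<forall>v\<in>verts G. {u, v} \<in> edges G \<longrightarrow> c u \<noteq> c v)"

definition chromatic_number :: "'a graph \<Rightarrow> nat" where
  "chromatic_number G = (LEAST k. \<exists>c. proper_colouring G k c)"

text \<open>The infimum of a non-empty set of natural numbers is its minimum.\<close>

definition family_chromatic_number :: "nat graph set \<Rightarrow> nat" where
  "family_chromatic_number \<F> = (INF F\<in>\<F>. chromatic_number F)"


section \<open>The edit distance function\<close>

definition graph_dist :: "'a graph \<Rightarrow> 'a graph \<Rightarrow> real" where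
  "graph_dist G H = real (card (sym_diff (edges G) (edges H))) / real (card (verts G) choose 2)"

text \<open>The minima and maxima in the next two definitions range over finite sets of values, which are
  non-empty when the property is non-trivial and \<open>p \<in> {0..1}\<close>.\<close>

definition dist_property :: "nat graph \<Rightarrow> nat graph set \<Rightarrow> real" where
  "dist_property G \<H> = Min {graph_dist G H |H. H \<in> \<H> \<and> verts H = verts G}"

definition max_dist :: "nat graph set \<Rightarrow> real \<Rightarrow> nat \<Rightarrow> real" where
  "max_dist \<H> p n =
     Max {dist_property G \<H> |G. is_graph G \<and> card (verts G) = n \<and>
                                int (card (edges G)) = \<lfloor>p * real (n choose 2)\<rfloor>}"

text \<open>The limit superior is taken in the extended reals; it lies in \<open>{0..1}\<close> for non-trivial
  properties.\<close>

definition ed :: "nat graph set \<Rightarrow> real \<Rightarrow> real" where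
  "ed \<H> p = real_of_ereal (limsup (\<lambda>n. ereal (max_dist \<H> p n)))"


section \<open>Colored regularity graphs\<close>

record 'a crg =
  VB :: "'a set"
  VW :: "'a set"
  EB :: "'a set set"
  EW :: "'a set set"
  EG :: "'a set set"

definition crg_verts :: "'a crg \<Rightarrow> 'a set" where
  "crg_verts K = VB K \<union> VW K"

definition is_crg :: "'a crg \<Rightarrow> bool" where
  "is_crg K \<longleftrightarrow>
     finite (crg_verts K) \<and> crg_verts K \<noteq> {} \<and> VB K \<inter> VW K = {} \<and>
     EB K \<union> EW K \<union> EG K = [crg_verts K]\<^bsup>2\<^esup> \<and>
     EB K \<inter> EW K = {} \<and> EB K \<inter> EG K = {} \<and> EW K \<inter> EG K = {}"

definition maps_to :: "'a graph \<Rightarrow> 'b crg \<Rightarrow> bool" (infix \<open>\<mapsto>\<close> 50) where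
  "F \<mapsto> K \<longleftrightarrow>
     (\<exists>\<phi>. \<phi> ` verts F \<subseteq> crg_verts K \<and>
        (\<forall>u\<in>verts F. \<forall>v\<in>verts F. {u, v} \<in> edges F \<longrightarrow>
            \<phi> u = \<phi> v \<and> \<phi> u \<in> VB K \<or> {\<phi> u, \<phi> v} \<in> EB K \<union> EG K) \<and>
        (\<forall>u\<in>verts F. \<forall>v\<in>verts F. u \<noteq> v \<and> {u, v} \<notin> edges F \<longrightarrow>
            \<phi> u = \<phi> v \<and> \<phi> u \<in> VW K \<or> {\<phi> u, \<phi> v} \<in> EW K \<union> EG K))"

text \<open>The set \<open>\<K>(Forb \<F>)\<close>. As for graphs, CRGs are taken on \<open>nat\<close>.\<close>

definition CRGs :: "nat graph set \<Rightarrow> nat crg set" where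
  "CRGs \<F> = {K. is_crg K \<and> (\<forall>F\<in>\<F>. \<not> F \<mapsto> K)}"

definition crg_matrix :: "'a crg \<Rightarrow> real \<Rightarrow> 'a \<Rightarrow> 'a \<Rightarrow> real" where
  "crg_matrix K p x y =
     (if (x = y \<and> x \<in> VW K) \<or> {x, y} \<in> EW K then p
      else if (x = y \<and> x \<in> VB K) \<or> {x, y} \<in> EB K then 1 - p
      else 0)"

definition prob_masses :: "'a set \<Rightarrow> ('a \<Rightarrow> real) set" where
  "prob_masses V = {\<mu>. (\<forall>x\<in>V. 0 \<le> \<mu> x) \<and> (\<Sum>x\<in>V. \<mu> x) = 1}"

text \<open>For a CRG the infimum is attained, by compactness of the simplex.\<close>

definition g :: "'a crg \<Rightarrow> real \<Rightarrow> real" where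
  "g K p = (INF \<mu>\<in>prob_masses (crg_verts K).
              \<Sum>x\<in>crg_verts K. \<Sum>y\<in>crg_verts K. \<mu> x * crg_matrix K p x y * \<mu> y)"

definition zero_core :: "'a crg \<Rightarrow> bool" where
  "zero_core K \<longleftrightarrow> EB K = {} \<and> EW K \<subseteq> [VB K]\<^bsup>2\<^esup>"

definition CRGs0 :: "nat graph set \<Rightarrow> nat crg set" where
  "CRGs0 \<F> = {K \<in> CRGs \<F>. zero_core K}"

text \<open>The infimum is a minimum when \<open>\<F>\<close> is non-empty and \<open>Forb \<F>\<close> is non-trivial. Let \<open>F \<in> \<F>\<close> have
  chromatic number \<open>\<chi> = family_chromatic_number \<F>\<close>. In each \<open>K\<close> below, a set of \<open>card (verts F)\<close>
  black vertices whose pairs are all white or all gray would give \<open>F \<mapsto> K\<close>, so by Ramsey's theorem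
  there are only finitely many such \<open>K\<close> up to isomorphism. Non-triviality forces \<open>\<chi> \<ge> 1\<close>, so the
  subtraction does not truncate.\<close>

definition q :: "nat graph set \<Rightarrow> real \<Rightarrow> real" where
  "q \<F> p = (INF K\<in>{K \<in> CRGs0 \<F>. card (VW K) = family_chromatic_number \<F> - 1}. g K p)"

definition regular_point :: "nat graph set \<Rightarrow> real \<Rightarrow> bool" where
  "regular_point \<F> p0 \<longleftrightarrow> p0 \<in> {0..1} \<and>
     (\<exists>\<epsilon>>0. \<exists>\<K>'. finite \<K>' \<and> \<K>' \<noteq> {} \<and> \<K>' \<subseteq> CRGs \<F> \<and>
        (\<forall>p \<in> {p0 - \<epsilon><..<p0 + \<epsilon>} \<inter> {0..1}. ed (Forb \<F>) p = (MIN K\<in>\<K>'. g K p)))"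

end

theory Submission
  imports Defs
begin

text \<open>Write \<open>\<chi>\<close> for \<open>family_chromatic_number \<F>\<close>, \<open>\<H>\<close> for \<open>Forb \<F>\<close>, and call \<open>\<langle>\<mu>, M\<^sub>K(p) \<mu>\<rangle>\<close> the energy of
  \<open>\<mu>\<close>, so that \<open>g K p\<close> is the least energy of a mass on the vertices of \<open>K\<close>. Regularity at \<open>0\<close>
  presents \<open>ed\<close> near \<open>0\<close> as a minimum of finitely many \<open>g\<close>, and the theorem says that near \<open>0\<close> such a
  minimum always agrees with the one over 0-core CRGs with \<open>\<chi> - 1\<close> white vertices.

  The bound \<open>ed \<H> p \<le> g K p\<close> for all \<open>K\<close> in \<open>CRGs \<F>\<close> (\<open>ed_le_g\<close>) holds for every \<open>p \<in> {0..1}\<close>: send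
  the vertices of a graph \<open>G\<close> independently at random to the vertices of \<open>K\<close> according to \<open>\<mu>\<close>, delete
  the edges that land on white pairs and add the non-edges that land on black pairs. The result lies
  in \<open>\<H>\<close>, because an induced copy of some \<open>F \<in> \<F>\<close> in it would map to \<open>K\<close>, and the expected
  proportion of altered pairs is the energy of \<open>\<mu>\<close> up to an error that vanishes as \<open>G\<close> grows. In
  particular \<open>ed \<H> p \<le> q \<F> p\<close>.

  For the other inequality, \<open>q \<F> p \<le> g K p\<close> as soon as \<open>p\<close> is small in terms of the number of vertices
  of \<open>K\<close> (\<open>q_le_g_CRGs\<close>). A mass on \<open>K\<close> can be moved, without increasing its energy, to a sub-CRG \<open>L\<close>
  that is 0-core (\<open>zero_core_sub_crg\<close>). A 0-core member of \<open>CRGs \<F>\<close> has at most \<open>\<chi> - 1\<close> white vertices,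
  since \<open>\<chi>\<close> of them would receive a \<open>\<chi>\<close>-colourable member of \<open>\<F>\<close>. If \<open>L\<close> has exactly \<open>\<chi> - 1\<close>, the energy
  is at least \<open>g L p \<ge> q \<F> p\<close>. If it has fewer, the diagonal alone makes the energy too large: by
  Cauchy-Schwarz it is at least the inverse of \<open>w/p + b/(1 - p)\<close> for \<open>w \<le> \<chi> - 2\<close> white and \<open>b\<close> black
  vertices, which for small \<open>p\<close> is at least \<open>p/(\<chi> - 1)\<close>, whereas \<open>\<chi> - 1\<close> white vertices joined by
  gray edges show \<open>q \<F> p \<le> p/(\<chi> - 1)\<close>. A finite set of CRGs admits a common bound on the number of
  vertices, so regularity at \<open>0\<close> gives \<open>ed \<H> p \<ge> q \<F> p\<close> for all small \<open>p\<close>.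

  Conversely, by Ramsey's theorem only finitely many CRGs up to isomorphism compete in the definition
  of \<open>q\<close> (\<open>finite_representatives\<close>), so \<open>q\<close> is a minimum of finitely many \<open>g\<close>, and an equality
  \<open>ed \<H> = q \<F>\<close> on \<open>{0<..<\<delta>}\<close> is what regularity asks for away from the point \<open>0\<close> itself. There it
  follows by letting \<open>p\<close> tend to \<open>0\<close> in \<open>g K 0 \<le> g K p + p\<close> and \<open>ed \<H> p \<le> ed \<H> 0 + p\<close>.\<close>


section \<open>Quadratic forms on the simplex\<close>

definition bform :: "'a set \<Rightarrow> ('a \<Rightarrow> 'a \<Rightarrow> real) \<Rightarrow> ('a \<Rightarrow> real) \<Rightarrow> ('a \<Rightarrow> real) \<Rightarrow> real" where
  "bform V M a b = (\<Sum>x\<in>V. \<Sum>y\<in>V. a x * M x y * b y)"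

lemma bform_add_left: "bform V M (\<lambda>x. a x + s * a' x) b = bform V M a b + s * bform V M a' b"
  unfolding bform_def sum_distrib_left sum.distrib[symmetric]
  by (intro sum.cong refl) (simp add: algebra_simps)

lemma bform_add_right: "bform V M a (\<lambda>x. b x + s * b' x) = bform V M a b + s * bform V M a b'"
  unfolding bform_def sum_distrib_left sum.distrib[symmetric]
  by (intro sum.cong refl) (simp add: algebra_simps)

lemma bform_commute:
  assumes "\<And>x y. M x y = M y x"
  shows "bform V M a b = bform V M b a"
proof -
  have "a x * M x y * b y = b y * M y x * a x" for x y
    unfolding assms[of x y] by simp
  then show ?thesis unfolding bform_def by (subst sum.swap) (simp only:)
qed

lemma bform_line:
  assumes "\<And>x y. M x y = M y x"
  shows "bform V M (\<lambda>x. a x + s * d x) (\<lambda>x. a x + s * d x)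
         = bform V M a a + 2 * s * bform V M a d + s\<^sup>2 * bform V M d d"
  unfolding bform_add_left bform_add_right bform_commute[where M=M and a=d and b=a, OF assms]
  by (simp add: algebra_simps power2_eq_square)

lemma sum_unit: "finite V \<Longrightarrow> y \<in> V \<Longrightarrow> (\<Sum>z\<in>V. f z * of_bool (z = y)) = (f y :: real)"
  by (subst sum.mono_neutral_right[where S="{y}"]) auto

lemma bform_unit_right:
  assumes "finite V" "y \<in> V"
  shows "bform V M a (\<lambda>z. of_bool (z = y)) = (\<Sum>x\<in>V. a x * M x y)"
  unfolding bform_def by (intro sum.cong refl sum_unit assms)

lemma bform_unit_unit:
  assumes "finite V" "x \<in> V" "y \<in> V"
  shows "bform V M (\<lambda>z. of_bool (z = x)) (\<lambda>z. of_bool (z = y)) = M x y"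
  unfolding bform_unit_right[OF assms(1,3)]
  using sum_unit[OF assms(1,2), of "\<lambda>x. M x y"] by (simp only: mult.commute)

lemma bform_mono_left:
  assumes "\<And>x. x \<in> V \<Longrightarrow> a x \<le> a' x" "\<And>x y. x \<in> V \<Longrightarrow> y \<in> V \<Longrightarrow> 0 \<le> M x y" "\<And>x. x \<in> V \<Longrightarrow> 0 \<le> b x"
  shows "bform V M a b \<le> bform V M a' b"
  unfolding bform_def by (intro sum_mono mult_right_mono) (auto simp: assms)

lemma bform_subset:
  assumes "finite V" "U \<subseteq> V" "\<And>x. x \<in> V - U \<Longrightarrow> a x = 0"
  shows "bform U M a a = bform V M a a"
proof -
  have "bform V M a a = (\<Sum>x\<in>U. \<Sum>y\<in>V. a x * M x y * a y)"
    unfolding bform_def using assms by (intro sum.mono_neutral_right) auto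
  also have "\<dots> = bform U M a a"
    unfolding bform_def using assms by (intro sum.cong sum.mono_neutral_right) auto
  finally show ?thesis by simp
qed

text \<open>Since the coordinates of \<open>d\<close> sum to \<open>0\<close> and do not all vanish, one of them is negative; the ray from
  \<open>\<mu>\<close> along \<open>d\<close> therefore leaves the simplex, and at its last point some coordinate is \<open>0\<close>.\<close>

lemma simplex_exit:
  fixes \<mu> d :: "'a \<Rightarrow> real"
  assumes V: "finite V" and pos: "\<And>x. x \<in> V \<Longrightarrow> 0 < \<mu> x"
    and d: "(\<Sum>x\<in>V. d x) = 0" "\<exists>x\<in>V. d x \<noteq> 0"
  shows "\<exists>s>0. (\<forall>x\<in>V. 0 \<le> \<mu> x + s * d x) \<and> (\<exists>x\<in>V. \<mu> x + s * d x = 0)"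
proof -
  define N where "N = {x\<in>V. d x < 0}"
  have "N \<noteq> {}"
  proof
    assume "N = {}"
    then have "\<forall>x\<in>V. 0 \<le> d x" by (auto simp: N_def not_less)
    then have "\<forall>x\<in>V. d x = 0" using d(1) V by (simp add: sum_nonneg_eq_0_iff)
    then show False using d(2) by blast
  qed
  moreover have fin: "finite N" using V by (simp add: N_def)
  ultimately obtain x where x: "x \<in> N" "\<And>y. y \<in> N \<Longrightarrow> \<mu> x / - d x \<le> \<mu> y / - d y"
    using arg_min_if_finite[of N "\<lambda>x. \<mu> x / - d x"] by (metis not_le)
  define s where "s = \<mu> x / - d x"
  have xV: "x \<in> V" "d x < 0" using x by (auto simp: N_def)
  have "s > 0" unfolding s_def using xV pos[of x] by (intro divide_pos_pos) auto
  moreover have "0 \<le> \<mu> y + s * d y" if y: "y \<in> V" for y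
  proof (cases "d y < 0")
    case True
    then have "s \<le> \<mu> y / - d y" using x(2)[of y] y by (auto simp: N_def s_def)
    then show ?thesis using True by (simp add: field_simps)
  next
    case False
    then show ?thesis using \<open>s > 0\<close> pos[OF y] by (intro add_nonneg_nonneg mult_nonneg_nonneg) auto
  qed
  moreover have "\<mu> x + s * d x = 0" using xV by (simp add: s_def field_simps)
  ultimately show ?thesis using xV by blast
qed

text \<open>Along a line of direction \<open>d\<close> with \<open>\<langle>d, M d\<rangle> \<le> 0\<close> the quadratic form is concave, so following the line
  in the direction of non-positive slope never increases it, and it may be followed up to the boundary
  of the simplex.\<close>

lemma drop_support:
  assumes V: "finite V" and pos: "\<And>x. x \<in> V \<Longrightarrow> 0 < \<mu> x" and \<mu>: "\<mu> \<in> prob_masses V"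
    and M: "\<And>x y. M x y = M y x"
    and d: "(\<Sum>x\<in>V. d x) = 0" "\<exists>x\<in>V. d x \<noteq> 0"
    and curv: "bform V M d d \<le> 0"
  shows "\<exists>\<mu>'\<in>prob_masses V. (\<exists>x\<in>V. \<mu>' x = 0) \<and> bform V M \<mu>' \<mu>' \<le> bform V M \<mu> \<mu>"
proof -
  \<comment> \<open>The orientation of \<open>d\<close> for which the slope at \<open>\<mu>\<close> is not positive.\<close>
  define e where "e = (\<lambda>x. (if bform V M \<mu> d \<le> 0 then 1 else - 1) * d x)"
  have ee: "bform V M e e = bform V M d d" by (auto simp: e_def bform_def)
  have "bform V M \<mu> e = (if bform V M \<mu> d \<le> 0 then 1 else - 1) * bform V M \<mu> d"
    by (simp add: e_def bform_def sum_negf)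
  then have \<mu>e: "bform V M \<mu> e \<le> 0" by auto
  have "(\<Sum>x\<in>V. e x) = 0" "\<exists>x\<in>V. e x \<noteq> 0"
    using d by (auto simp: e_def sum_negf)
  from simplex_exit[where \<mu>=\<mu> and d=e, OF V pos this] obtain s where s: "s > 0"
    "\<forall>x\<in>V. 0 \<le> \<mu> x + s * e x" "\<exists>x\<in>V. \<mu> x + s * e x = 0" by blast
  have "bform V M (\<lambda>x. \<mu> x + s * e x) (\<lambda>x. \<mu> x + s * e x) \<le> bform V M \<mu> \<mu>"
    unfolding bform_line[OF M] using s(1) \<mu>e curv
    by (simp add: ee mult_nonneg_nonpos add_nonpos_nonpos)
  moreover have "(\<lambda>x. \<mu> x + s * e x) \<in> prob_masses V"
    using \<mu> s(2) \<open>(\<Sum>x\<in>V. e x) = 0\<close>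
    by (simp add: prob_masses_def sum.distrib flip: sum_distrib_left)
  ultimately show ?thesis using s(3) by (intro bexI[of _ "\<lambda>x. \<mu> x + s * e x"] conjI)
qed


section \<open>The matrix of a CRG\<close>

lemma crg_matrix_commute: "crg_matrix K p x y = crg_matrix K p y x"
proof -
  have "{x, y} = {y, x}" by auto
  then show ?thesis by (cases "x = y") (simp_all add: crg_matrix_def)
qed

lemma crg_matrix_nonneg: "0 \<le> p \<Longrightarrow> p \<le> 1 \<Longrightarrow> 0 \<le> crg_matrix K p x y"
  by (simp add: crg_matrix_def)

lemma crg_verts_finite: "is_crg K \<Longrightarrow> finite (crg_verts K)"
  and crg_verts_nonempty: "is_crg K \<Longrightarrow> crg_verts K \<noteq> {}"
  by (simp_all add: is_crg_def)

lemma crg_edge_doubleton: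
  assumes "is_crg K" "{x, y} \<in> EB K \<union> EW K \<union> EG K"
  shows "x \<in> crg_verts K" "y \<in> crg_verts K" "x \<noteq> y"
proof -
  have "{x, y} \<in> [crg_verts K]\<^bsup>2\<^esup>" using assms by (simp add: is_crg_def)
  then show "x \<in> crg_verts K" "y \<in> crg_verts K" "x \<noteq> y" by auto
qed

lemma crg_no_loop: "is_crg K \<Longrightarrow> {x} \<notin> EB K" "is_crg K \<Longrightarrow> {x} \<notin> EW K" "is_crg K \<Longrightarrow> {x} \<notin> EG K"
  using crg_edge_doubleton(3)[of K x x] by auto

lemma crg_disjoint:
  assumes "is_crg K"
  shows "x \<in> VB K \<Longrightarrow> x \<notin> VW K" "e \<in> EB K \<Longrightarrow> e \<notin> EW K" "e \<in> EG K \<Longrightarrow> e \<notin> EB K" "e \<in> EG K \<Longrightarrow> e \<notin> EW K"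
proof -
  have "VB K \<inter> VW K = {}" "EB K \<inter> EW K = {}" "EB K \<inter> EG K = {}" "EW K \<inter> EG K = {}"
    using assms by (simp_all add: is_crg_def)
  then show "x \<in> VB K \<Longrightarrow> x \<notin> VW K" "e \<in> EB K \<Longrightarrow> e \<notin> EW K" "e \<in> EG K \<Longrightarrow> e \<notin> EB K" "e \<in> EG K \<Longrightarrow> e \<notin> EW K"
    by blast+
qed

lemma crg_edge_cases:
  assumes "is_crg K" "x \<in> crg_verts K" "y \<in> crg_verts K" "x \<noteq> y"
  shows "{x, y} \<in> EB K \<or> {x, y} \<in> EW K \<or> {x, y} \<in> EG K"
proof -
  have "{x, y} \<in> EB K \<union> EW K \<union> EG K" using assms by (simp add: is_crg_def)
  then show ?thesis by blast
qed

lemma crg_matrix_diag: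
  assumes "is_crg K"
  shows "x \<in> VW K \<Longrightarrow> crg_matrix K p x x = p" "x \<in> VB K \<Longrightarrow> crg_matrix K p x x = 1 - p"
  by (simp_all add: crg_matrix_def crg_no_loop[OF assms] crg_disjoint[OF assms])

lemma crg_matrix_edge:
  assumes "is_crg K"
  shows "{x, y} \<in> EW K \<Longrightarrow> crg_matrix K p x y = p" "{x, y} \<in> EB K \<Longrightarrow> crg_matrix K p x y = 1 - p"
    "{x, y} \<in> EG K \<Longrightarrow> crg_matrix K p x y = 0"
  using crg_edge_doubleton(3)[OF assms, of x y]
  by (simp_all add: crg_matrix_def crg_disjoint[OF assms])

lemma energy_nonneg:
  assumes "0 \<le> p" "p \<le> 1" "\<mu> \<in> prob_masses V"
  shows "0 \<le> bform V (crg_matrix K p) \<mu> \<mu>"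
  unfolding bform_def using assms
  by (intro sum_nonneg mult_nonneg_nonneg crg_matrix_nonneg) (auto simp: prob_masses_def)

lemma g_eq: "g K p = (INF \<mu>\<in>prob_masses (crg_verts K). bform (crg_verts K) (crg_matrix K p) \<mu> \<mu>)"
  by (simp add: g_def bform_def)

lemma g_le:
  assumes "0 \<le> p" "p \<le> 1" "\<mu> \<in> prob_masses (crg_verts K)"
  shows "g K p \<le> bform (crg_verts K) (crg_matrix K p) \<mu> \<mu>"
  unfolding g_eq using assms
  by (intro cINF_lower bdd_belowI[where m=0]) (auto intro: energy_nonneg)

lemma prob_masses_nonempty: "finite V \<Longrightarrow> V \<noteq> {} \<Longrightarrow> prob_masses V \<noteq> {}"
proof -
  assume V: "finite V" "V \<noteq> {}"
  then obtain x where "x \<in> V" by blast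
  then have "(\<lambda>z. of_bool (z = x)) \<in> prob_masses V"
    using V sum_unit[of V x "\<lambda>_. 1"] by (simp add: prob_masses_def)
  then show ?thesis by blast
qed

lemma g_greatest:
  assumes "is_crg K"
    and "\<And>\<mu>. \<mu> \<in> prob_masses (crg_verts K) \<Longrightarrow> c \<le> bform (crg_verts K) (crg_matrix K p) \<mu> \<mu>"
  shows "c \<le> g K p"
  unfolding g_eq using assms prob_masses_nonempty[of "crg_verts K"]
    crg_verts_finite[OF assms(1)] crg_verts_nonempty[OF assms(1)]
  by (intro cINF_greatest) auto

lemma g_nonneg: "is_crg K \<Longrightarrow> 0 \<le> p \<Longrightarrow> p \<le> 1 \<Longrightarrow> 0 \<le> g K p"
  by (rule g_greatest) (auto intro: energy_nonneg)


section \<open>Sub-CRGs\<close>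

text \<open>The CRG on \<open>U\<close> in which \<open>h\<close> transports all colours from \<open>K\<close>. For the identity this is the sub-CRG on
  \<open>U\<close>, and for a bijection it is an isomorphic copy, so that one set of lemmas serves both purposes.\<close>

definition pull_crg :: "('b \<Rightarrow> 'a) \<Rightarrow> 'b set \<Rightarrow> 'a crg \<Rightarrow> 'b crg" where
  "pull_crg h U K =
     \<lparr>VB = {x\<in>U. h x \<in> VB K}, VW = {x\<in>U. h x \<in> VW K},
      EB = {e\<in>[U]\<^bsup>2\<^esup>. h ` e \<in> EB K}, EW = {e\<in>[U]\<^bsup>2\<^esup>. h ` e \<in> EW K},
      EG = {e\<in>[U]\<^bsup>2\<^esup>. h ` e \<in> EG K}\<rparr>"

lemma pull_crg_sel [simp]:
  "VB (pull_crg h U K) = {x\<in>U. h x \<in> VB K}" "VW (pull_crg h U K) = {x\<in>U. h x \<in> VW K}"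
  "EB (pull_crg h U K) = {e\<in>[U]\<^bsup>2\<^esup>. h ` e \<in> EB K}" "EW (pull_crg h U K) = {e\<in>[U]\<^bsup>2\<^esup>. h ` e \<in> EW K}"
  "EG (pull_crg h U K) = {e\<in>[U]\<^bsup>2\<^esup>. h ` e \<in> EG K}"
  by (simp_all add: pull_crg_def)

lemma pull_crg_verts: "h ` U \<subseteq> crg_verts K \<Longrightarrow> crg_verts (pull_crg h U K) = U"
  by (auto simp: crg_verts_def)

lemma pull_crg_is_crg:
  assumes K: "is_crg K" and h: "h ` U \<subseteq> crg_verts K" "inj_on h U" and U: "finite U" "U \<noteq> {}"
  shows "is_crg (pull_crg h U K)"
proof -
  have "h ` e \<in> EB K \<union> EW K \<union> EG K" if e: "e \<in> [U]\<^bsup>2\<^esup>" for e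
  proof -
    obtain x y where "e = {x, y}" "x \<in> U" "y \<in> U" "x \<noteq> y"
      using e by (auto elim!: nsets2_E)
    then have "h ` e \<in> [crg_verts K]\<^bsup>2\<^esup>" using h by (auto simp: inj_on_eq_iff)
    then show ?thesis using K by (simp add: is_crg_def)
  qed
  then have "EB (pull_crg h U K) \<union> EW (pull_crg h U K) \<union> EG (pull_crg h U K) = [U]\<^bsup>2\<^esup>"
    by auto
  moreover have "VB (pull_crg h U K) \<inter> VW (pull_crg h U K) = {}"
    "EB (pull_crg h U K) \<inter> EW (pull_crg h U K) = {}" "EB (pull_crg h U K) \<inter> EG (pull_crg h U K) = {}"
    "EW (pull_crg h U K) \<inter> EG (pull_crg h U K) = {}"
    using crg_disjoint[OF K] by auto
  ultimately show ?thesis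
    unfolding is_crg_def pull_crg_verts[OF h(1)] using U by blast
qed

lemma maps_toI:
  assumes "\<And>u. u \<in> verts F \<Longrightarrow> \<phi> u \<in> crg_verts K"
    and "\<And>u v. u \<in> verts F \<Longrightarrow> v \<in> verts F \<Longrightarrow> {u, v} \<in> edges F \<Longrightarrow>
      \<phi> u = \<phi> v \<and> \<phi> u \<in> VB K \<or> {\<phi> u, \<phi> v} \<in> EB K \<or> {\<phi> u, \<phi> v} \<in> EG K"
    and "\<And>u v. u \<in> verts F \<Longrightarrow> v \<in> verts F \<Longrightarrow> u \<noteq> v \<Longrightarrow> {u, v} \<notin> edges F \<Longrightarrow>
      \<phi> u = \<phi> v \<and> \<phi> u \<in> VW K \<or> {\<phi> u, \<phi> v} \<in> EW K \<or> {\<phi> u, \<phi> v} \<in> EG K"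
  shows "F \<mapsto> K"
  unfolding maps_to_def Un_iff
  by (intro exI[of _ \<phi>] conjI ballI impI image_subsetI assms) simp_all

lemma maps_toE:
  assumes "F \<mapsto> K"
  obtains \<phi> where "\<And>u. u \<in> verts F \<Longrightarrow> \<phi> u \<in> crg_verts K"
    and "\<And>u v. u \<in> verts F \<Longrightarrow> v \<in> verts F \<Longrightarrow> {u, v} \<in> edges F \<Longrightarrow>
      \<phi> u = \<phi> v \<and> \<phi> u \<in> VB K \<or> {\<phi> u, \<phi> v} \<in> EB K \<or> {\<phi> u, \<phi> v} \<in> EG K"
    and "\<And>u v. u \<in> verts F \<Longrightarrow> v \<in> verts F \<Longrightarrow> u \<noteq> v \<Longrightarrow> {u, v} \<notin> edges F \<Longrightarrow>
      \<phi> u = \<phi> v \<and> \<phi> u \<in> VW K \<or> {\<phi> u, \<phi> v} \<in> EW K \<or> {\<phi> u, \<phi> v} \<in> EG K"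
proof -
  obtain \<phi> where \<phi>: "\<phi> ` verts F \<subseteq> crg_verts K \<and>
    (\<forall>u\<in>verts F. \<forall>v\<in>verts F. {u, v} \<in> edges F \<longrightarrow>
      \<phi> u = \<phi> v \<and> \<phi> u \<in> VB K \<or> {\<phi> u, \<phi> v} \<in> EB K \<union> EG K) \<and>
    (\<forall>u\<in>verts F. \<forall>v\<in>verts F. u \<noteq> v \<and> {u, v} \<notin> edges F \<longrightarrow>
      \<phi> u = \<phi> v \<and> \<phi> u \<in> VW K \<or> {\<phi> u, \<phi> v} \<in> EW K \<union> EG K)"
    using assms unfolding maps_to_def by (rule exE)
  show thesis by (rule that[of \<phi>]) (use \<phi> in \<open>simp_all add: image_subset_iff\<close>)
qed

text \<open>Composition with \<open>h\<close> preserves colours. With \<open>pull_crg_is_crg\<close> this makes \<open>CRGs \<F>\<close> closed under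
  sub-CRGs and isomorphic copies.\<close>

lemma pull_crg_maps_to:
  assumes "F \<mapsto> pull_crg h U K"
  shows "F \<mapsto> K"
  using assms
proof (rule maps_toE)
  fix \<phi>
  assume \<phi>: "\<And>u. u \<in> verts F \<Longrightarrow> \<phi> u \<in> crg_verts (pull_crg h U K)"
    "\<And>u v. u \<in> verts F \<Longrightarrow> v \<in> verts F \<Longrightarrow> {u, v} \<in> edges F \<Longrightarrow> \<phi> u = \<phi> v \<and> \<phi> u \<in> VB (pull_crg h U K) \<or>
      {\<phi> u, \<phi> v} \<in> EB (pull_crg h U K) \<or> {\<phi> u, \<phi> v} \<in> EG (pull_crg h U K)"
    "\<And>u v. u \<in> verts F \<Longrightarrow> v \<in> verts F \<Longrightarrow> u \<noteq> v \<Longrightarrow> {u, v} \<notin> edges F \<Longrightarrow> \<phi> u = \<phi> v \<and> \<phi> u \<in> VW (pull_crg h U K) \<or>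
      {\<phi> u, \<phi> v} \<in> EW (pull_crg h U K) \<or> {\<phi> u, \<phi> v} \<in> EG (pull_crg h U K)"
  show ?thesis
  proof (rule maps_toI[where \<phi>="h \<circ> \<phi>"])
    fix u assume "u \<in> verts F"
    from \<phi>(1)[OF this] show "(h \<circ> \<phi>) u \<in> crg_verts K" by (auto simp: crg_verts_def)
  next
    fix u v assume "u \<in> verts F" "v \<in> verts F" "{u, v} \<in> edges F"
    from \<phi>(2)[OF this] show "(h \<circ> \<phi>) u = (h \<circ> \<phi>) v \<and> (h \<circ> \<phi>) u \<in> VB K \<or>
        {(h \<circ> \<phi>) u, (h \<circ> \<phi>) v} \<in> EB K \<or> {(h \<circ> \<phi>) u, (h \<circ> \<phi>) v} \<in> EG K" by auto
  next
    fix u v assume "u \<in> verts F" "v \<in> verts F" "u \<noteq> v" "{u, v} \<notin> edges F"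
    from \<phi>(3)[OF this] show "(h \<circ> \<phi>) u = (h \<circ> \<phi>) v \<and> (h \<circ> \<phi>) u \<in> VW K \<or>
        {(h \<circ> \<phi>) u, (h \<circ> \<phi>) v} \<in> EW K \<or> {(h \<circ> \<phi>) u, (h \<circ> \<phi>) v} \<in> EG K" by auto
  qed
qed

lemma pull_crg_in_CRGs:
  assumes "K \<in> CRGs \<F>" "h ` U \<subseteq> crg_verts K" "inj_on h U" "finite U" "U \<noteq> {}"
  shows "pull_crg h U K \<in> CRGs \<F>"
  using assms pull_crg_is_crg[of K h U] pull_crg_maps_to[of _ h U K] by (auto simp: CRGs_def)

lemma pull_crg_matrix:
  assumes K: "is_crg K" and h: "inj_on h U" and xy: "x \<in> U" "y \<in> U"
  shows "crg_matrix (pull_crg h U K) p x y = crg_matrix K p (h x) (h y)"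
  using xy inj_on_eq_iff[OF h xy] crg_no_loop[OF K, of "h x"]
  by (cases "x = y") (simp_all add: crg_matrix_def)

lemma pull_crg_zero_core: "zero_core K \<Longrightarrow> zero_core (pull_crg h U K)"
  unfolding zero_core_def by (force simp: nsets_def)

lemma pull_crg_g:
  assumes K: "is_crg K" and h: "bij_betw h U (crg_verts K)"
    and p: "0 \<le> p" "p \<le> 1"
  shows "g (pull_crg h U K) p = g K p"
proof -
  let ?V = "crg_verts K"
  have inj: "inj_on h U" and im: "h ` U = ?V" using h by (auto simp: bij_betw_def)
  have V: "crg_verts (pull_crg h U K) = U" using im by (intro pull_crg_verts) auto
  have e1: "bform U (crg_matrix (pull_crg h U K) p) (\<mu> \<circ> h) (\<mu> \<circ> h) = bform ?V (crg_matrix K p) \<mu> \<mu>" for \<mu>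
    unfolding bform_def im[symmetric]
    by (simp add: sum.reindex[OF inj] pull_crg_matrix[OF K inj])
  show ?thesis
  proof (rule antisym)
    show "g (pull_crg h U K) p \<le> g K p"
    proof (rule g_greatest[OF K])
      fix \<mu> assume "\<mu> \<in> prob_masses ?V"
      then have "\<mu> \<circ> h \<in> prob_masses (crg_verts (pull_crg h U K))"
        unfolding V im[symmetric] by (auto simp: prob_masses_def sum.reindex[OF inj])
      from g_le[OF p this] show "g (pull_crg h U K) p \<le> bform ?V (crg_matrix K p) \<mu> \<mu>"
        by (simp add: V e1)
    qed
    show "g K p \<le> g (pull_crg h U K) p"
    proof (rule g_greatest)
      show "is_crg (pull_crg h U K)"
        using crg_verts_finite[OF K] crg_verts_nonempty[OF K] bij_betw_finite[OF h] inj im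
        by (intro pull_crg_is_crg[OF K]) auto
      fix \<nu> assume \<nu>: "\<nu> \<in> prob_masses (crg_verts (pull_crg h U K))"
      define \<mu> where "\<mu> = \<nu> \<circ> inv_into U h"
      have \<mu>h: "\<mu> (h x) = \<nu> x" if "x \<in> U" for x
        using that inj by (simp add: \<mu>_def)
      have "\<mu> \<in> prob_masses ?V"
        using \<nu> unfolding V im[symmetric] by (simp add: prob_masses_def sum.reindex[OF inj] \<mu>h)
      from g_le[OF p this] have "g K p \<le> bform U (crg_matrix (pull_crg h U K) p) (\<mu> \<circ> h) (\<mu> \<circ> h)"
        by (simp add: e1)
      then show "g K p \<le> bform (crg_verts (pull_crg h U K)) (crg_matrix (pull_crg h U K) p) \<nu> \<nu>"
        unfolding V by (simp add: bform_def \<mu>h)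
    qed
  qed
qed


section \<open>Reduction to 0-core sub-CRGs\<close>

text \<open>The obstructions to being 0-core are black edges and white edges with a white endpoint, and each of
  them yields a direction along which one vertex can be emptied.

  For a black edge \<open>xy\<close> the direction is \<open>e\<^sub>y - e\<^sub>x\<close>: its curvature \<open>M\<^sub>x\<^sub>x + M\<^sub>y\<^sub>y - 2 M\<^sub>x\<^sub>y\<close> is at most \<open>0\<close>,
  because \<open>p \<le> 1/2\<close> makes \<open>1 - p\<close> the largest possible entry.

  For a white edge at a white vertex \<open>x\<close>, exchanging mass with a single neighbour does not suffice, since
  for a black neighbour the curvature is \<open>1 - 2p\<close>. One exchanges \<open>x\<close> with all of its white neighbours
  at once: let \<open>\<nu>\<close> be the restriction of \<open>\<mu>\<close> to them, \<open>s\<close> its total mass and \<open>d = \<nu> - s e\<^sub>x\<close>. All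
  other vertices are joined to \<open>x\<close> by gray edges, which makes \<open>\<langle>d, M d\<rangle> = \<langle>\<nu>, M \<nu>\<rangle> - p s\<^sup>2\<close> and
  \<open>\<langle>\<mu>, M d\<rangle> \<ge> \<langle>d, M d\<rangle>\<close>. So either the curvature along \<open>d\<close> is not positive, or replacing \<open>\<mu>\<close> by \<open>\<mu> - d\<close>,
  which moves the mass of all white neighbours to \<open>x\<close>, changes the energy by
  \<open>\<langle>d, M d\<rangle> - 2 \<langle>\<mu>, M d\<rangle> \<le> - \<langle>d, M d\<rangle> \<le> 0\<close>.\<close>

lemma not_zero_core_drop:
  assumes K: "is_crg K" and p: "0 \<le> p" "p \<le> 1/2"
    and \<mu>: "\<mu> \<in> prob_masses (crg_verts K)" and nz: "\<not> zero_core K"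
  defines "V \<equiv> crg_verts K" and "M \<equiv> crg_matrix K p"
  shows "\<exists>\<mu>'\<in>prob_masses V. (\<exists>x\<in>V. \<mu>' x = 0) \<and> bform V M \<mu>' \<mu>' \<le> bform V M \<mu> \<mu>"
proof (cases "\<exists>x\<in>V. \<mu> x = 0")
  case True
  then show ?thesis using \<mu> unfolding V_def by blast
next
  case False
  have V: "finite V" unfolding V_def by (rule crg_verts_finite[OF K])
  have pos: "0 < \<mu> x" if "x \<in> V" for x
    using False \<mu> that by (auto simp: prob_masses_def V_def less_le)
  have M_comm: "M x y = M y x" for x y unfolding M_def by (rule crg_matrix_commute)
  have M_nonneg: "0 \<le> M x y" for x y unfolding M_def using p by (intro crg_matrix_nonneg) auto
  have M_diag: "M x x \<le> 1 - p" if "x \<in> V" for x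
    using that crg_matrix_diag[OF K, of x p] p by (auto simp: V_def M_def crg_verts_def)
  have sum1: "(\<Sum>z\<in>V. of_bool (z = x)) = (1::real)" if "x \<in> V" for x
    using sum_unit[OF V that, of "\<lambda>_. 1"] by simp
  show ?thesis
  proof (cases "EB K = {}")
    case False
    then obtain e where e: "e \<in> EB K" by blast
    then have "e \<in> [V]\<^bsup>2\<^esup>" using K unfolding is_crg_def V_def by blast
    then obtain x y where xy: "e = {x, y}" "x \<in> V" "y \<in> V" "x \<noteq> y" by (auto elim!: nsets2_E)
    define d :: "'a \<Rightarrow> real" where "d = (\<lambda>z. of_bool (z = y) + (- 1) * of_bool (z = x))"
    have "M y x = 1 - p"
      using crg_matrix_edge(2)[OF K, of y x p] e xy(1) by (simp add: M_def insert_commute)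
    then have "bform V M d d \<le> 0"
      unfolding d_def bform_line[where M=M, OF M_comm]
      using M_diag[OF xy(2)] M_diag[OF xy(3)] by (simp add: bform_unit_unit[OF V] xy)
    moreover have "(\<Sum>z\<in>V. d z) = 0"
      unfolding d_def by (simp add: sum_subtractf sum1 xy)
    moreover have "\<exists>z\<in>V. d z \<noteq> 0" using xy by (intro bexI[of _ x]) (auto simp: d_def)
    ultimately show ?thesis
      using \<mu> V pos M_comm unfolding V_def[symmetric] by (intro drop_support) auto
  next
    case True
    then have "\<not> EW K \<subseteq> [VB K]\<^bsup>2\<^esup>" using nz by (simp add: zero_core_def)
    then obtain e where e: "e \<in> EW K" "e \<notin> [VB K]\<^bsup>2\<^esup>" by blast
    then have "e \<in> [V]\<^bsup>2\<^esup>" using K unfolding is_crg_def V_def by blast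
    then obtain x' y' where e': "e = {x', y'}" "x' \<in> V" "y' \<in> V" "x' \<noteq> y'" by (auto elim!: nsets2_E)
    then have "e = {y', x'}" by auto
    have "x' \<in> VW K \<or> y' \<in> VW K" using e(2) e' by (auto simp: V_def crg_verts_def)
    then obtain x y where xy: "{x, y} \<in> EW K" "x \<in> VW K" "x \<in> V" "y \<in> V"
      using e(1) e' \<open>e = {y', x'}\<close> by metis
    define N where "N = {z \<in> V. {x, z} \<in> EW K}"
    define \<nu> where "\<nu> = (\<lambda>z. if z \<in> N then \<mu> z else 0)"
    define s where "s = (\<Sum>z\<in>V. \<nu> z)"
    define u :: "'a \<Rightarrow> real" where "u = (\<lambda>z. of_bool (z = x))"
    define d where "d = (\<lambda>z. \<nu> z + (- s) * u z)"
    have xN: "x \<notin> N" using crg_no_loop(2)[OF K, of x] by (auto simp: N_def)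
    have yN: "y \<in> N" using xy by (simp add: N_def)
    have \<nu>_nonneg: "0 \<le> \<nu> z" "\<nu> z \<le> \<mu> z" if "z \<in> V" for z
      using pos[OF that] by (auto simp: \<nu>_def)
    have "0 < \<nu> y" using yN pos[OF xy(4)] by (simp add: \<nu>_def)
    then have s_pos: "0 < s" unfolding s_def
      using V xy(4) \<nu>_nonneg(1) by (intro sum_pos2) auto
    have Mx: "M z x = p * (of_bool (z = x) + of_bool (z \<in> N))" if z: "z \<in> V" for z
    proof (cases "z = x \<or> z \<in> N")
      case True
      then show ?thesis
        using xN crg_matrix_diag(1)[OF K xy(2), of p] crg_matrix_edge(1)[OF K, of x z p] M_comm[of z x]
        by (auto simp: M_def N_def)
    next
      case False
      then have "{x, z} \<in> EG K"
        using crg_edge_cases[OF K, of x z] z xy(3) True by (auto simp: N_def V_def)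
      then show ?thesis
        using False crg_matrix_edge(3)[OF K, of x z p] M_comm[of z x] by (simp add: M_def)
    qed
    have to_x: "bform V M a u = p * (a x + (\<Sum>z\<in>V. a z * of_bool (z \<in> N)))" for a
    proof -
      have "bform V M a u = (\<Sum>z\<in>V. p * (a z * of_bool (z = x)) + p * (a z * of_bool (z \<in> N)))"
        unfolding u_def bform_unit_right[OF V xy(3)]
        by (intro sum.cong refl) (simp add: Mx algebra_simps)
      then show ?thesis
        by (simp only: sum.distrib sum_unit[OF V xy(3)] distrib_left flip: sum_distrib_left)
    qed
    have sN: "(\<Sum>z\<in>V. \<mu> z * of_bool (z \<in> N)) = s" "(\<Sum>z\<in>V. \<nu> z * of_bool (z \<in> N)) = s"
      unfolding s_def by (intro sum.cong refl; simp add: \<nu>_def)+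
    have \<mu>u: "bform V M \<mu> u = p * (\<mu> x + s)" and \<nu>u: "bform V M \<nu> u = p * s" and uu: "bform V M u u = p"
      unfolding to_x sN using xN by (simp_all add: \<nu>_def) (simp add: u_def xN sum.neutral)
    have dd: "bform V M d d = bform V M \<nu> \<nu> - p * s\<^sup>2"
      unfolding d_def bform_line[where M=M, OF M_comm] \<nu>u uu by (simp add: power2_eq_square algebra_simps)
    \<comment> \<open>As all entries of \<open>M\<close> are non-negative, forgetting the mass outside \<open>x\<close> and \<open>N\<close> only lowers the form.\<close>
    have "bform V M (\<lambda>z. \<nu> z + \<mu> x * u z) \<nu> \<le> bform V M \<mu> \<nu>"
    proof (rule bform_mono_left)
      fix z assume "z \<in> V"
      then show "\<nu> z + \<mu> x * u z \<le> \<mu> z" using pos[OF \<open>z \<in> V\<close>] xN by (auto simp: \<nu>_def u_def)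
    qed (use M_nonneg \<nu>_nonneg in auto)
    then have "bform V M \<nu> \<nu> + \<mu> x * (p * s) \<le> bform V M \<mu> \<nu>"
      unfolding bform_add_left bform_commute[where M=M and a=u and b=\<nu>, OF M_comm] \<nu>u .
    then have \<mu>d: "bform V M d d \<le> bform V M \<mu> d"
      unfolding dd unfolding d_def bform_add_right \<mu>u by (simp add: power2_eq_square algebra_simps)
    have sum_d: "(\<Sum>z\<in>V. d z) = 0"
      unfolding d_def sum.distrib s_def[symmetric] u_def sum_distrib_left[symmetric] sum1[OF xy(3)] by simp
    show ?thesis
    proof (cases "bform V M d d \<le> 0")
      case True
      moreover have "\<exists>z\<in>V. d z \<noteq> 0"
        using xy(3) xN s_pos by (intro bexI[of _ x]) (auto simp: d_def u_def \<nu>_def)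
      ultimately show ?thesis
        using \<mu> V pos M_comm sum_d unfolding V_def[symmetric] by (intro drop_support) auto
    next
      case False
      let ?\<mu>' = "\<lambda>z. \<mu> z + (- 1) * d z"
      have "bform V M ?\<mu>' ?\<mu>' \<le> bform V M \<mu> \<mu>"
        unfolding bform_line[where M=M, OF M_comm] using \<mu>d False by simp
      moreover have "?\<mu>' \<in> prob_masses V"
      proof -
        have "0 \<le> ?\<mu>' z" if "z \<in> V" for z
        proof (cases "z = x")
          case True
          then show ?thesis using xN pos[OF that] s_pos by (simp add: d_def \<nu>_def u_def)
        qed (use \<nu>_nonneg[OF that] in \<open>simp add: d_def u_def\<close>)
        moreover have "(\<Sum>z\<in>V. ?\<mu>' z) = 1"
          using \<mu> sum_d by (simp add: sum_subtractf prob_masses_def V_def)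
        ultimately show ?thesis by (simp add: prob_masses_def)
      qed
      moreover have "?\<mu>' y = 0" using yN xN by (auto simp: d_def u_def \<nu>_def)
      ultimately show ?thesis using xy(4) by (intro bexI[of _ ?\<mu>'] conjI bexI[of _ y])
    qed
  qed
qed

abbreviation sub_crg :: "'a set \<Rightarrow> 'a crg \<Rightarrow> 'a crg" where
  "sub_crg \<equiv> pull_crg (\<lambda>x. x)"

lemma sub_crg_bform:
  assumes "is_crg K"
  shows "bform U (crg_matrix (sub_crg U K) p) \<mu> \<nu> = bform U (crg_matrix K p) \<mu> \<nu>"
  unfolding bform_def by (intro sum.cong refl) (simp add: pull_crg_matrix[OF assms])

text \<open>While the sub-CRG on \<open>U\<close> is not 0-core, one of its vertices can be emptied and discarded; this ends,
  at the latest, with a single vertex.\<close>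

lemma zero_core_sub_crg:
  assumes K: "is_crg K" and p: "0 \<le> p" "p \<le> 1/2"
    and U: "U \<subseteq> crg_verts K" "U \<noteq> {}" "\<mu> \<in> prob_masses U"
  shows "\<exists>U' \<mu>'. U' \<subseteq> U \<and> U' \<noteq> {} \<and> zero_core (sub_crg U' K) \<and> \<mu>' \<in> prob_masses U' \<and>
    bform U' (crg_matrix K p) \<mu>' \<mu>' \<le> bform U (crg_matrix K p) \<mu> \<mu>"
proof -
  have "finite U" using U(1) crg_verts_finite[OF K] by (rule finite_subset)
  then show ?thesis using U
  proof (induction U arbitrary: \<mu> rule: finite_psubset_induct)
    case (psubset U)
    show ?case
    proof (cases "zero_core (sub_crg U K)")
      case True
      with psubset.prems show ?thesis by blast
    next
      case False
      have V: "crg_verts (sub_crg U K) = U"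
        using psubset.prems(1) by (intro pull_crg_verts) simp
      have "is_crg (sub_crg U K)"
        using psubset.prems psubset.hyps by (intro pull_crg_is_crg K) auto
      from not_zero_core_drop[OF this p _ False, of \<mu>] psubset.prems(3)
      obtain \<mu>' x where \<mu>': "\<mu>' \<in> prob_masses U" "x \<in> U" "\<mu>' x = 0"
        "bform U (crg_matrix K p) \<mu>' \<mu>' \<le> bform U (crg_matrix K p) \<mu> \<mu>"
        unfolding V sub_crg_bform[OF K] by blast
      have sum: "(\<Sum>z\<in>U - {x}. \<mu>' z) = (\<Sum>z\<in>U. \<mu>' z)"
        using psubset.hyps \<mu>'(3) by (intro sum.mono_neutral_left) auto
      then have pm: "\<mu>' \<in> prob_masses (U - {x})"
        using \<mu>'(1) by (simp add: prob_masses_def)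
      have ne: "U - {x} \<noteq> {}"
      proof
        assume "U - {x} = {}"
        then have "(\<Sum>z\<in>U. \<mu>' z) = 0" using sum by (simp only: sum.empty)
        then show False using \<mu>'(1) by (simp add: prob_masses_def)
      qed
      have "bform (U - {x}) (crg_matrix K p) \<mu>' \<mu>' = bform U (crg_matrix K p) \<mu>' \<mu>'"
        using psubset.hyps \<mu>'(3) by (intro bform_subset) auto
      with \<mu>'(4) have le: "bform (U - {x}) (crg_matrix K p) \<mu>' \<mu>' \<le> bform U (crg_matrix K p) \<mu> \<mu>"
        by simp
      have "U - {x} \<subset> U" "U - {x} \<subseteq> crg_verts K" using \<mu>'(2) psubset.prems(1) by auto
      from psubset.IH[OF this ne pm] obtain U' \<mu>'' where U': "U' \<subseteq> U - {x}" "U' \<noteq> {}"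
        "zero_core (sub_crg U' K)" "\<mu>'' \<in> prob_masses U'"
        "bform U' (crg_matrix K p) \<mu>'' \<mu>'' \<le> bform (U - {x}) (crg_matrix K p) \<mu>' \<mu>'"
        by (elim exE conjE)
      have "U' \<subseteq> U" using U'(1) by blast
      with U' order_trans[OF U'(5) le] show ?thesis by (intro exI conjI)
    qed
  qed
qed


section \<open>Chromatic number and white vertices\<close>

lemma graph_edge:
  assumes "is_graph F" "{u, v} \<in> edges F"
  shows "u \<in> verts F" "v \<in> verts F" "u \<noteq> v"
proof -
  have "{u, v} \<in> [verts F]\<^bsup>2\<^esup>" using assms unfolding is_graph_def by (blast dest: subsetD)
  then show "u \<in> verts F" "v \<in> verts F" "u \<noteq> v" by auto
qed

lemma chromatic_number_colouring:
  assumes "is_graph F"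
  shows "\<exists>c. proper_colouring F (chromatic_number F) c"
proof -
  have "finite (verts F)" using assms by (simp add: is_graph_def)
  then obtain c where c: "bij_betw c (verts F) {..<card (verts F)}"
    using ex_bij_betw_finite_nat[of "verts F"] by (auto simp: atLeast0LessThan)
  have "proper_colouring F (card (verts F)) c"
    unfolding proper_colouring_def
  proof (intro conjI ballI impI)
    fix u v assume uv: "u \<in> verts F" "v \<in> verts F" "{u, v} \<in> edges F"
    then show "c u \<noteq> c v" using graph_edge(3)[OF assms uv(3)] c by (auto simp: bij_betw_def inj_on_def)
  qed (use c in \<open>simp add: bij_betw_def\<close>)
  then show ?thesis
    unfolding chromatic_number_def
    by (intro LeastI[where P="\<lambda>k. \<exists>c. proper_colouring F k c"] exI[of _ c])
qed

lemma family_chromatic_number_attained: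
  assumes "\<F> \<noteq> {}"
  obtains F where "F \<in> \<F>" "chromatic_number F = family_chromatic_number \<F>"
proof -
  have "family_chromatic_number \<F> \<in> chromatic_number ` \<F>"
    unfolding family_chromatic_number_def using assms by (intro Inf_nat_def1) auto
  then show ?thesis using that by (metis imageE)
qed

lemma family_chromatic_number_le:
  assumes "F \<in> \<F>" "proper_colouring F k c"
  shows "family_chromatic_number \<F> \<le> k"
proof -
  have "family_chromatic_number \<F> \<le> chromatic_number F"
    unfolding family_chromatic_number_def using assms(1) by (intro cINF_lower) auto
  also have "\<dots> \<le> k"
    unfolding chromatic_number_def using assms(2) by (intro Least_le) blast
  finally show ?thesis .
qed

lemma zero_core_gray:
  assumes K: "is_crg K" "zero_core K" and xy: "x \<in> VW K" "y \<in> crg_verts K" "x \<noteq> y"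
  shows "{x, y} \<in> EG K"
proof -
  have "x \<in> crg_verts K" using xy by (simp add: crg_verts_def)
  moreover have "{x, y} \<notin> EW K"
  proof
    assume "{x, y} \<in> EW K"
    then have "{x, y} \<in> [VB K]\<^bsup>2\<^esup>" using K(2) unfolding zero_core_def by (blast dest: subsetD)
    then have "x \<in> VB K" by simp
    then show False using crg_disjoint(1)[OF K(1), of x] xy(1) by blast
  qed
  moreover have "{x, y} \<notin> EB K" using K(2) by (simp add: zero_core_def)
  ultimately show ?thesis using crg_edge_cases[OF K(1) _ xy(2,3)] by blast
qed

text \<open>In a 0-core CRG white vertices are joined by gray edges only, so a proper colouring of \<open>F\<close> whose
  colours are distinct white vertices is itself a map \<open>F \<mapsto> K\<close>: edges fall on gray pairs, and
  non-edges on gray pairs or inside a white vertex.\<close>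

lemma zero_core_card_white_less:
  assumes \<F>: "\<And>F. F \<in> \<F> \<Longrightarrow> is_graph F" "\<F> \<noteq> {}" and K: "K \<in> CRGs \<F>" "zero_core K"
  shows "card (VW K) < family_chromatic_number \<F>"
proof (rule ccontr)
  assume "\<not> ?thesis"
  then have le: "card {..<family_chromatic_number \<F>} \<le> card (VW K)" by simp
  have crg: "is_crg K" using K by (simp add: CRGs_def)
  have "finite (VW K)" using crg_verts_finite[OF crg] by (simp add: crg_verts_def)
  then obtain f where f: "f ` {..<family_chromatic_number \<F>} \<subseteq> VW K"
    "inj_on f {..<family_chromatic_number \<F>}"
    using card_le_inj[OF _ _ le] by auto
  obtain F where F: "F \<in> \<F>" "chromatic_number F = family_chromatic_number \<F>"
    using family_chromatic_number_attained[OF \<F>(2)] by blast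
  then obtain c where c: "proper_colouring F (family_chromatic_number \<F>) c"
    using chromatic_number_colouring[OF \<F>(1)[OF F(1)]] by auto
  have fc: "f (c u) \<in> VW K" "f (c u) \<in> crg_verts K" if "u \<in> verts F" for u
    using that c f(1) by (auto simp: proper_colouring_def crg_verts_def)
  have "F \<mapsto> K"
  proof (rule maps_toI[where \<phi>="\<lambda>u. f (c u)"])
    fix u v assume uv: "u \<in> verts F" "v \<in> verts F"
    {
      assume "{u, v} \<in> edges F"
      then have "c u \<noteq> c v" using c uv by (auto simp: proper_colouring_def)
      then have "f (c u) \<noteq> f (c v)"
        using f(2) c uv by (auto simp: proper_colouring_def inj_on_def)
      then show "f (c u) = f (c v) \<and> f (c u) \<in> VB K \<or> {f (c u), f (c v)} \<in> EB K \<or> {f (c u), f (c v)} \<in> EG K"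
        using zero_core_gray[OF crg K(2) fc(1) fc(2)] uv by blast
    }
    show "f (c u) = f (c v) \<and> f (c u) \<in> VW K \<or> {f (c u), f (c v)} \<in> EW K \<or> {f (c u), f (c v)} \<in> EG K"
      using zero_core_gray[OF crg K(2) fc(1) fc(2)] fc uv by blast
  qed (rule fc)
  then show False using K(1) F(1) by (auto simp: CRGs_def)
qed

text \<open>A map \<open>F \<mapsto> gray_clique k\<close> is precisely a proper colouring of \<open>F\<close> with \<open>k\<close> colours.\<close>

definition gray_clique :: "nat \<Rightarrow> nat crg" where
  "gray_clique k = \<lparr>VB = {}, VW = {..<k}, EB = {}, EW = {}, EG = [{..<k}]\<^bsup>2\<^esup>\<rparr>"

lemma gray_clique_sel [simp]:
  "VB (gray_clique k) = {}" "VW (gray_clique k) = {..<k}" "EB (gray_clique k) = {}"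
  "EW (gray_clique k) = {}" "EG (gray_clique k) = [{..<k}]\<^bsup>2\<^esup>" "crg_verts (gray_clique k) = {..<k}"
  by (simp_all add: gray_clique_def crg_verts_def)

lemma is_crg_gray_clique: "0 < k \<Longrightarrow> is_crg (gray_clique k)"
  by (auto simp: is_crg_def lessThan_empty_iff)

lemma gray_clique_in_CRGs0:
  assumes "0 < k" "k < family_chromatic_number \<F>"
  shows "gray_clique k \<in> CRGs0 \<F>"
proof -
  have "\<not> F \<mapsto> gray_clique k" if F: "F \<in> \<F>" for F
  proof
    assume "F \<mapsto> gray_clique k"
    then show False
    proof (rule maps_toE)
      fix \<phi> assume \<phi>: "\<And>u. u \<in> verts F \<Longrightarrow> \<phi> u \<in> crg_verts (gray_clique k)"
        "\<And>u v. u \<in> verts F \<Longrightarrow> v \<in> verts F \<Longrightarrow> {u, v} \<in> edges F \<Longrightarrow>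
          \<phi> u = \<phi> v \<and> \<phi> u \<in> VB (gray_clique k) \<or> {\<phi> u, \<phi> v} \<in> EB (gray_clique k) \<or> {\<phi> u, \<phi> v} \<in> EG (gray_clique k)"
      have "\<phi> u \<noteq> \<phi> v" if "u \<in> verts F" "v \<in> verts F" "{u, v} \<in> edges F" for u v
        using \<phi>(2)[OF that] by simp
      then have "proper_colouring F k \<phi>"
        using \<phi>(1) by (auto simp: proper_colouring_def)
      from family_chromatic_number_le[OF F this] assms(2) show False by simp
    qed
  qed
  then show ?thesis
    using is_crg_gray_clique[OF assms(1)] by (simp add: CRGs0_def CRGs_def zero_core_def)
qed

lemma g_gray_clique_le:
  assumes "0 \<le> p" "p \<le> 1" "0 < k"
  shows "g (gray_clique k) p \<le> p / k"
proof -
  let ?\<mu> = "\<lambda>_::nat. 1 / real k"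
  have "g (gray_clique k) p \<le> bform {..<k} (crg_matrix (gray_clique k) p) ?\<mu> ?\<mu>"
    using g_le[of p ?\<mu> "gray_clique k"] assms by (simp add: prob_masses_def)
  also have "\<dots> = (\<Sum>x<k. \<Sum>y<k. (p / real k ^ 2) * of_bool (y = x))"
    unfolding bform_def
    by (intro sum.cong refl) (auto simp: crg_matrix_def power2_eq_square)
  also have "\<dots> = (\<Sum>x<k. p / real k ^ 2)"
    by (intro sum.cong refl sum_unit) auto
  also have "\<dots> = p / k" using assms by (simp add: power2_eq_square)
  finally show ?thesis .
qed

lemma q_le_g:
  assumes "0 \<le> p" "p \<le> 1" "K \<in> CRGs0 \<F>" "card (VW K) = family_chromatic_number \<F> - 1"
  shows "q \<F> p \<le> g K p"
  unfolding q_def using assms g_nonneg[OF _ assms(1,2)]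
  by (intro cINF_lower bdd_belowI2[where m=0]) (auto simp: CRGs0_def CRGs_def)

text \<open>All entries of the matrix are non-negative, so the energy is at least the contribution
  \<open>\<Sum>\<^sub>x m\<^sub>x \<mu>\<^sub>x\<^sup>2\<close> of the diagonal \<open>m\<close>, and Cauchy-Schwarz gives
  \<open>1 = (\<Sum>\<^sub>x \<mu>\<^sub>x)\<^sup>2 \<le> (\<Sum>\<^sub>x m\<^sub>x \<mu>\<^sub>x\<^sup>2) (\<Sum>\<^sub>x 1/m\<^sub>x)\<close>.\<close>

lemma energy_ge_harmonic:
  assumes K: "is_crg K" and p: "0 < p" "p < 1" and \<mu>: "\<mu> \<in> prob_masses (crg_verts K)"
  shows "1 \<le> bform (crg_verts K) (crg_matrix K p) \<mu> \<mu> * (card (VW K) / p + card (VB K) / (1 - p))"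
proof -
  let ?V = "crg_verts K"
  define m where "m = (\<lambda>x. crg_matrix K p x x)"
  have fin: "finite ?V" by (rule crg_verts_finite[OF K])
  have m_pos: "0 < m x" if "x \<in> ?V" for x
    using that crg_matrix_diag[OF K, of x p] p by (auto simp: m_def crg_verts_def)
  have "1 = (\<Sum>x\<in>?V. (sqrt (m x) * \<mu> x) * (1 / sqrt (m x)))\<^sup>2"
  proof -
    have "(\<Sum>x\<in>?V. (sqrt (m x) * \<mu> x) * (1 / sqrt (m x))) = (\<Sum>x\<in>?V. \<mu> x)"
      by (intro sum.cong refl) (use m_pos in \<open>force simp: less_imp_neq\<close>)
    then show ?thesis using \<mu> by (simp add: prob_masses_def)
  qed
  also have "\<dots> \<le> (\<Sum>x\<in>?V. (sqrt (m x) * \<mu> x)\<^sup>2) * (\<Sum>x\<in>?V. (1 / sqrt (m x))\<^sup>2)"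
    by (rule Cauchy_Schwarz_ineq_sum)
  also have "\<dots> \<le> bform ?V (crg_matrix K p) \<mu> \<mu> * (card (VW K) / p + card (VB K) / (1 - p))"
  proof (rule mult_mono)
    show "(\<Sum>x\<in>?V. (sqrt (m x) * \<mu> x)\<^sup>2) \<le> bform ?V (crg_matrix K p) \<mu> \<mu>"
      unfolding bform_def
    proof (rule sum_mono)
      fix x assume x: "x \<in> ?V"
      have "(sqrt (m x) * \<mu> x)\<^sup>2 = \<mu> x * crg_matrix K p x x * \<mu> x"
        using m_pos[OF x] by (simp add: power_mult_distrib power2_eq_square m_def)
      also have "\<dots> \<le> (\<Sum>y\<in>?V. \<mu> x * crg_matrix K p x y * \<mu> y)"
        using \<mu> x fin p crg_matrix_nonneg[of p K]
        by (intro member_le_sum) (auto simp: prob_masses_def)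
      finally show "(sqrt (m x) * \<mu> x)\<^sup>2 \<le> (\<Sum>y\<in>?V. \<mu> x * crg_matrix K p x y * \<mu> y)" .
    qed
    have "(\<Sum>x\<in>?V. (1 / sqrt (m x))\<^sup>2) = (\<Sum>x\<in>?V. 1 / m x)"
      by (intro sum.cong refl) (use m_pos in \<open>simp add: power_divide less_imp_le\<close>)
    also have "\<dots> = (\<Sum>x\<in>VB K. 1 / m x) + (\<Sum>x\<in>VW K. 1 / m x)"
      using fin K unfolding crg_verts_def by (intro sum.union_disjoint) (auto simp: is_crg_def)
    also have "\<dots> = card (VW K) / p + card (VB K) / (1 - p)"
      by (simp add: m_def crg_matrix_diag[OF K])
    finally show "(\<Sum>x\<in>?V. (1 / sqrt (m x))\<^sup>2) \<le> card (VW K) / p + card (VB K) / (1 - p)" by simp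
  qed (use p energy_nonneg[of p \<mu> ?V K] \<mu> in \<open>auto intro: sum_nonneg\<close>)
  finally show ?thesis .
qed

text \<open>A mass on \<open>K\<close> is first moved to a 0-core sub-CRG \<open>L\<close>. What remains is to compare \<open>\<chi> - 1\<close> white vertices
  with fewer: as \<open>p\<close> tends to \<open>0\<close> a white vertex contributes \<open>1/p\<close> to the bound of
  \<open>energy_ge_harmonic\<close>, a black one only a bounded amount, and \<open>2 p |K| \<le> 1\<close> ensures that all black
  vertices together contribute no more than one white vertex.\<close>

lemma q_le_g_CRGs:
  fixes p :: real
  assumes \<F>: "\<And>F. F \<in> \<F> \<Longrightarrow> is_graph F" "\<F> \<noteq> {}" and K: "K \<in> CRGs \<F>"
    and p: "0 < p" "p \<le> 1/2" "2 * p * card (crg_verts K) \<le> 1"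
  shows "q \<F> p \<le> g K p"
proof (rule g_greatest)
  show crg: "is_crg K" using K by (simp add: CRGs_def)
  fix \<mu> assume "\<mu> \<in> prob_masses (crg_verts K)"
  from zero_core_sub_crg[OF crg _ p(2) _ _ this] p(1) crg_verts_nonempty[OF crg]
  obtain U \<nu> where U: "U \<subseteq> crg_verts K" "U \<noteq> {}" "zero_core (sub_crg U K)" "\<nu> \<in> prob_masses U"
    "bform U (crg_matrix K p) \<nu> \<nu> \<le> bform (crg_verts K) (crg_matrix K p) \<mu> \<mu>" by auto
  define L where "L = sub_crg U K"
  define k where "k = family_chromatic_number \<F> - 1"
  have V: "crg_verts L = U" unfolding L_def using U(1) by (intro pull_crg_verts) simp
  have L: "L \<in> CRGs \<F>" unfolding L_def
    using U crg_verts_finite[OF crg] by (intro pull_crg_in_CRGs[OF K]) (auto intro: finite_subset)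
  then have L_crg: "is_crg L" by (simp add: CRGs_def)
  have L0: "zero_core L" using U(3) by (simp add: L_def)
  have bL: "bform U (crg_matrix K p) \<nu> \<nu> = bform (crg_verts L) (crg_matrix L p) \<nu> \<nu>"
    unfolding V unfolding L_def by (rule sub_crg_bform[OF crg, symmetric])
  have "card (VW L) \<le> k"
    using zero_core_card_white_less[OF \<F> L L0] by (simp add: k_def)
  then consider "card (VW L) = k" | "card (VW L) + 1 \<le> k" by linarith
  then have "q \<F> p \<le> bform (crg_verts L) (crg_matrix L p) \<nu> \<nu>"
  proof cases
    case 1
    then have "q \<F> p \<le> g L p"
      using L L0 p by (intro q_le_g) (auto simp: CRGs0_def k_def)
    also have "\<dots> \<le> bform (crg_verts L) (crg_matrix L p) \<nu> \<nu>"
      using p U(4) by (intro g_le) (auto simp: V)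
    finally show ?thesis .
  next
    case 2
    let ?E = "bform (crg_verts L) (crg_matrix L p) \<nu> \<nu>"
    have k: "0 < k" "k < family_chromatic_number \<F>" using 2 by (auto simp: k_def)
    have "card (VB L) \<le> card (crg_verts K)"
      using crg_verts_finite[OF crg] U(1) by (intro card_mono) (auto simp: L_def crg_verts_def)
    then have "2 * p * card (VB L) \<le> 2 * p * card (crg_verts K)"
      using p(1) by (intro mult_left_mono) auto
    then have "p * (2 * card (VB L)) \<le> 1" using p(3) by simp
    moreover have "card (VB L) / (1 - p) \<le> 2 * card (VB L)"
      using p divide_left_mono[of "1/2" "1 - p" "real (card (VB L))"] by simp
    ultimately have "p * (card (VB L) / (1 - p)) \<le> 1"
      using p(1) by (meson mult_left_mono order_trans less_imp_le)
    then have "card (VB L) / (1 - p) \<le> 1 / p"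
      using p(1) by (simp only: pos_le_divide_eq mult.commute)
    then have "card (VW L) / p + card (VB L) / (1 - p) \<le> (card (VW L) + 1) / p"
      by (simp add: add_divide_distrib)
    also have "\<dots> \<le> k / p" using 2 p(1) by (intro divide_right_mono) auto
    finally have "?E * (card (VW L) / p + card (VB L) / (1 - p)) \<le> ?E * (k / p)"
      using p U(4) by (intro mult_left_mono energy_nonneg) (auto simp: V)
    with energy_ge_harmonic[OF L_crg p(1), of \<nu>] p(2) U(4) have "1 \<le> ?E * (k / p)"
      by (simp add: V)
    then have "p / k \<le> ?E" using p(1) k(1) by (simp add: field_simps)
    moreover have "q \<F> p \<le> g (gray_clique k) p"
      using p gray_clique_in_CRGs0[OF k] by (intro q_le_g) (auto simp: k_def)
    moreover have "g (gray_clique k) p \<le> p / k"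
      using p k by (intro g_gray_clique_le) auto
    ultimately show ?thesis by linarith
  qed
  then show "q \<F> p \<le> bform (crg_verts K) (crg_matrix K p) \<mu> \<mu>" using U(5) bL by simp
qed


section \<open>Finitely many 0-core CRGs with the maximal number of white vertices\<close>

text \<open>Let \<open>F \<in> \<F>\<close> have chromatic number \<open>\<chi>\<close>. Among sufficiently many black vertices, Ramsey's theorem finds
  \<open>card (verts F)\<close> whose pairs are all gray or all white. In the first case every injection of \<open>F\<close> into
  them is a map to \<open>K\<close>. In the second case colour \<open>F\<close> properly with \<open>\<chi>\<close> colours, send \<open>\<chi> - 1\<close> of the
  classes to the white vertices, and place the last class, an independent set, injectively on the
  black ones.\<close>

lemma black_vertices_bounded:
  assumes \<F>: "\<And>F. F \<in> \<F> \<Longrightarrow> is_graph F" "\<F> \<noteq> {}"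
  shows "\<exists>r. \<forall>K\<in>CRGs0 \<F>. card (VW K) = family_chromatic_number \<F> - 1 \<longrightarrow> card (VB K) < r"
proof -
  let ?k = "family_chromatic_number \<F> - 1"
  obtain F where F: "F \<in> \<F>" "chromatic_number F = family_chromatic_number \<F>"
    using family_chromatic_number_attained[OF \<F>(2)] by blast
  then obtain c where c: "proper_colouring F (family_chromatic_number \<F>) c"
    using chromatic_number_colouring[OF \<F>(1)[OF F(1)]] by auto
  have c_range: "c u < family_chromatic_number \<F>" if "u \<in> verts F" for u
    using c that by (auto simp: proper_colouring_def)
  have c_edge: "c u \<noteq> c v" if "u \<in> verts F" "v \<in> verts F" "{u, v} \<in> edges F" for u v
    using c that by (simp add: proper_colouring_def)
  have F_fin: "finite (verts F)" using \<F>(1)[OF F(1)] by (simp add: is_graph_def)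
  obtain r where r: "\<And>(V :: nat set) E. finite V \<Longrightarrow> r \<le> card V \<Longrightarrow>
      \<exists>R\<subseteq>V. card R = card (verts F) \<and> clique R E \<or> card R = card (verts F) \<and> indep R E"
    using ramsey2[where 'a=nat, of "card (verts F)" "card (verts F)"] by blast
  have "card (VB K) < r" if K: "K \<in> CRGs0 \<F>" and white: "card (VW K) = ?k" for K
  proof (rule ccontr)
    assume "\<not> card (VB K) < r"
    have crg: "is_crg K" and core: "zero_core K" and no_map: "\<not> F \<mapsto> K"
      using K F(1) by (auto simp: CRGs0_def CRGs_def)
    have fin: "finite (VB K)" "finite (VW K)"
      using crg_verts_finite[OF crg] by (auto simp: crg_verts_def)
    obtain R where R: "R \<subseteq> VB K" "card R = card (verts F)" "clique R (EG K) \<or> indep R (EG K)"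
      using r[OF fin(1), of "EG K"] \<open>\<not> card (VB K) < r\<close> by (meson not_less)
    have "finite R" using R(1) fin(1) by (rule finite_subset)
    then obtain h where "bij_betw h (verts F) R"
      using finite_same_card_bij[OF F_fin] R(2) by metis
    then have h: "inj_on h (verts F)" "\<And>u. u \<in> verts F \<Longrightarrow> h u \<in> R"
      by (auto simp: bij_betw_def)
    have hV: "h u \<in> VB K" "h u \<in> crg_verts K" if "u \<in> verts F" for u
      using h(2)[OF that] R(1) by (auto simp: crg_verts_def)
    have h_neq: "h u \<noteq> h v" if "u \<in> verts F" "v \<in> verts F" "u \<noteq> v" for u v
      using h(1) that by (simp add: inj_on_eq_iff)
    show False
      using R(3)
    proof
      assume gray: "clique R (EG K)"
      then have "{h u, h v} \<in> EG K" if "u \<in> verts F" "v \<in> verts F" "u \<noteq> v" for u v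
        using h(2) that h_neq[OF that] by (simp add: clique_def)
      then have "F \<mapsto> K"
        using hV graph_edge(3)[OF \<F>(1)[OF F(1)]] by (intro maps_toI[where \<phi>=h]) auto
      then show False using no_map by simp
    next
      assume white_pairs: "indep R (EG K)"
      have "card {..<?k} \<le> card (VW K)" using white by simp
      from card_le_inj[OF _ fin(2) this] obtain f
        where f: "f ` {..<?k} \<subseteq> VW K" "inj_on f {..<?k}" by auto
      define \<phi> where "\<phi> = (\<lambda>u. if c u < ?k then f (c u) else h u)"
      have \<phi>_white: "\<phi> u \<in> VW K" if "c u < ?k" for u
        using that f(1) by (auto simp: \<phi>_def)
      have \<phi>_black: "\<phi> u = h u" "c u = ?k" if "u \<in> verts F" "\<not> c u < ?k" for u
        using that c_range[of u] by (auto simp: \<phi>_def)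
      have \<phi>_verts: "\<phi> u \<in> crg_verts K" if "u \<in> verts F" for u
        using \<phi>_white[of u] \<phi>_black(1)[OF that] hV(2)[OF that]
        by (cases "c u < ?k") (auto simp: crg_verts_def)
      have gray: "{\<phi> u, \<phi> v} \<in> EG K"
        if "u \<in> verts F" "v \<in> verts F" "\<phi> u \<noteq> \<phi> v" "c u < ?k \<or> c v < ?k" for u v
        using that(4)
      proof
        assume "c v < ?k"
        then have "{\<phi> v, \<phi> u} \<in> EG K"
          using that \<phi>_white \<phi>_verts by (intro zero_core_gray[OF crg core]) auto
        then show ?thesis by (simp only: insert_commute)
      qed (use that \<phi>_white \<phi>_verts in \<open>auto intro!: zero_core_gray[OF crg core]\<close>)
      have "F \<mapsto> K"
      proof (rule maps_toI[where \<phi>=\<phi>])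
        fix u v assume uv: "u \<in> verts F" "v \<in> verts F" "{u, v} \<in> edges F"
        have neq: "c u \<noteq> c v" by (rule c_edge[OF uv])
        then have some_white: "c u < ?k \<or> c v < ?k"
          using \<phi>_black(2)[OF uv(1)] \<phi>_black(2)[OF uv(2)] by metis
        have disj: "\<phi> a \<noteq> \<phi> b" if "c a < ?k" "\<not> c b < ?k" "b \<in> verts F" for a b
          using \<phi>_white[OF that(1)] \<phi>_black(1)[OF that(3,2)] hV(1)[OF that(3)]
            crg_disjoint(1)[OF crg] by metis
        have "\<phi> u \<noteq> \<phi> v"
        proof (cases "c u < ?k \<and> c v < ?k")
          case True
          then show ?thesis using f(2) neq by (simp add: \<phi>_def inj_on_eq_iff)
        next
          case False
          then show ?thesis using some_white disj[of u v] disj[of v u] uv by metis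
        qed
        then show "\<phi> u = \<phi> v \<and> \<phi> u \<in> VB K \<or> {\<phi> u, \<phi> v} \<in> EB K \<or> {\<phi> u, \<phi> v} \<in> EG K"
          using gray[OF uv(1,2) _ some_white] by blast
      next
        fix u v assume uv: "u \<in> verts F" "v \<in> verts F" "u \<noteq> v"
        show "\<phi> u = \<phi> v \<and> \<phi> u \<in> VW K \<or> {\<phi> u, \<phi> v} \<in> EW K \<or> {\<phi> u, \<phi> v} \<in> EG K"
        proof (cases "c u < ?k \<or> c v < ?k")
          case True
          then show ?thesis using gray[OF uv(1,2) _ True] \<phi>_white[of u] \<phi>_white[of v] by metis
        next
          case False
          then have \<phi>: "\<phi> u = h u" "\<phi> v = h v" using \<phi>_black(1) uv by auto
          have "{h u, h v} \<notin> EG K"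
            using white_pairs h(2) uv h_neq[OF uv] by (simp add: indep_def)
          moreover have "{h u, h v} \<notin> EB K" using core by (simp add: zero_core_def)
          ultimately show ?thesis
            unfolding \<phi> using crg_edge_cases[OF crg hV(2) hV(2) h_neq] uv by metis
        qed
      qed (rule \<phi>_verts)
      then show False using no_map by simp
    qed
  qed
  then show ?thesis by blast
qed

lemma finite_crgs:
  assumes "finite V"
  shows "finite {K. is_crg K \<and> crg_verts K \<subseteq> V}"
proof (rule finite_subset)
  let ?P = "Pow V \<times> Pow V \<times> Pow (Pow V) \<times> Pow (Pow V) \<times> Pow (Pow V)"
  let ?f = "\<lambda>(b, w, eb, ew, eg). \<lparr>VB = b, VW = w, EB = eb, EW = ew, EG = eg\<rparr>"
  show "finite (?f ` ?P)" using assms by simp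
  show "{K. is_crg K \<and> crg_verts K \<subseteq> V} \<subseteq> ?f ` ?P"
  proof
    fix K assume "K \<in> {K. is_crg K \<and> crg_verts K \<subseteq> V}"
    then have K: "is_crg K" "crg_verts K \<subseteq> V" by auto
    have "EB K \<union> EW K \<union> EG K \<subseteq> Pow V"
      using K by (auto simp: is_crg_def nsets_def)
    moreover have "K = ?f (VB K, VW K, EB K, EW K, EG K)" by simp
    ultimately show "K \<in> ?f ` ?P"
      using K(2) unfolding crg_verts_def by (intro image_eqI[where x="(VB K, VW K, EB K, EW K, EG K)"]) auto
  qed
qed

text \<open>The bound on black vertices also bounds the order, so every competitor in the definition of \<open>q\<close>
  can be relabelled to live on a fixed initial segment of the natural numbers.\<close>

lemma finite_representatives:
  assumes \<F>: "\<And>F. F \<in> \<F> \<Longrightarrow> is_graph F" "\<F> \<noteq> {}"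
  defines "S \<equiv> {K \<in> CRGs0 \<F>. card (VW K) = family_chromatic_number \<F> - 1}"
  shows "\<exists>R\<subseteq>S. finite R \<and> (\<forall>K\<in>S. \<exists>L\<in>R. \<forall>p\<in>{0..1}. g L p = g K p)"
proof -
  obtain r where r: "\<And>K. K \<in> S \<Longrightarrow> card (VB K) < r"
    using black_vertices_bounded[OF \<F>] unfolding S_def by blast
  define n where "n = r + family_chromatic_number \<F>"
  define R where "R = {K \<in> S. crg_verts K \<subseteq> {..<n}}"
  have "R \<subseteq> {K. is_crg K \<and> crg_verts K \<subseteq> {..<n}}"
    by (auto simp: R_def S_def CRGs0_def CRGs_def)
  then have "finite R" by (rule finite_subset) (rule finite_crgs, simp)
  moreover have "\<exists>L\<in>R. \<forall>p\<in>{0..1}. g L p = g K p" if K: "K \<in> S" for K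
  proof -
    have KC: "K \<in> CRGs \<F>" and core: "zero_core K" and white: "card (VW K) = family_chromatic_number \<F> - 1"
      using K by (auto simp: S_def CRGs0_def)
    then have crg: "is_crg K" by (simp add: CRGs_def)
    have fin: "finite (crg_verts K)" by (rule crg_verts_finite[OF crg])
    have "card (crg_verts K) \<le> card (VB K) + card (VW K)"
      unfolding crg_verts_def by (rule card_Un_le)
    then have card_le: "card (crg_verts K) \<le> n" using r[OF K] white by (simp add: n_def)
    define U where "U = {..<card (crg_verts K)}"
    obtain h where h: "bij_betw h U (crg_verts K)"
      using ex_bij_betw_nat_finite[OF fin] by (auto simp: U_def atLeast0LessThan)
    then have hU: "h ` U \<subseteq> crg_verts K" "inj_on h U" by (auto simp: bij_betw_def)
    define L where "L = pull_crg h U K"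
    have "U \<noteq> {}" using h crg_verts_nonempty[OF crg] by (auto simp: bij_betw_def)
    then have "L \<in> CRGs \<F>"
      unfolding L_def by (intro pull_crg_in_CRGs KC hU) (simp_all add: U_def)
    moreover have "zero_core L" unfolding L_def by (rule pull_crg_zero_core[OF core])
    moreover have "card (VW L) = card (VW K)"
    proof (rule bij_betw_same_card)
      have "h ` VW L = VW K"
        using h by (fastforce simp: L_def bij_betw_def crg_verts_def)
      then show "bij_betw h (VW L) (VW K)"
        using hU(2) by (auto simp: bij_betw_def L_def intro: inj_on_subset)
    qed
    moreover have "crg_verts L = U" unfolding L_def by (rule pull_crg_verts[OF hU(1)])
    then have "crg_verts L \<subseteq> {..<n}" using card_le by (auto simp: U_def)
    ultimately have "L \<in> R" using white by (simp add: R_def S_def CRGs0_def)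
    moreover have "g L p = g K p" if "p \<in> {0..1}" for p
      unfolding L_def using that by (intro pull_crg_g crg h) auto
    ultimately show ?thesis by blast
  qed
  moreover have "R \<subseteq> S" by (auto simp: R_def)
  ultimately show ?thesis by (intro exI[of _ R] conjI ballI)
qed

lemma contains_inducedI:
  assumes "is_graph F" "is_graph G" "bij_betw h (verts F) R" "R \<subseteq> verts G"
    and "\<And>u v. u \<in> verts F \<Longrightarrow> v \<in> verts F \<Longrightarrow> u \<noteq> v \<Longrightarrow> {u, v} \<in> edges F \<longleftrightarrow> {h u, h v} \<in> edges G"
  shows "contains_induced G F"
  unfolding contains_induced_def
proof (intro exI[of _ h] conjI ballI)
  fix u v assume "u \<in> verts F" "v \<in> verts F"
  then show "{u, v} \<in> edges F \<longleftrightarrow> {h u, h v} \<in> edges G"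
    using assms(5) graph_edge(3)[OF assms(1), of v v] graph_edge(3)[OF assms(2), of "h v" "h v"]
    by (cases "u = v") auto
qed (use assms in \<open>auto simp: bij_betw_def\<close>)

text \<open>By Ramsey's theorem every sufficiently large graph contains either a clique on \<open>card (verts F)\<close> vertices
  or an independent set of size \<open>card (verts F')\<close>.\<close>

lemma clique_edgeless_trivial:
  assumes F: "F \<in> \<F>" "is_graph F" "\<And>u v. u \<in> verts F \<Longrightarrow> v \<in> verts F \<Longrightarrow> u \<noteq> v \<Longrightarrow> {u, v} \<in> edges F"
    and F': "F' \<in> \<F>" "is_graph F'" "\<And>u v. u \<in> verts F' \<Longrightarrow> v \<in> verts F' \<Longrightarrow> {u, v} \<notin> edges F'"
  shows "\<not> nontrivial_property (Forb \<F>)"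
proof
  assume nt: "nontrivial_property (Forb \<F>)"
  obtain r where r: "\<And>(V :: nat set) E. finite V \<Longrightarrow> r \<le> card V \<Longrightarrow>
      \<exists>R\<subseteq>V. card R = card (verts F) \<and> clique R E \<or> card R = card (verts F') \<and> indep R E"
    using ramsey2[where 'a=nat, of "card (verts F)" "card (verts F')"] by blast
  obtain G where G: "G \<in> Forb \<F>" "r \<le> card (verts G)"
    using nt by (auto simp: nontrivial_property_def)
  have gG: "is_graph G" using G(1) by (simp add: Forb_def)
  then have finG: "finite (verts G)" by (simp add: is_graph_def)
  have bij: "\<exists>h. bij_betw h (verts H) R" if "is_graph H" "R \<subseteq> verts G" "card R = card (verts H)" for H :: "nat graph" and R
    using finite_same_card_bij[of "verts H" R] that finite_subset[OF that(2) finG]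
    by (simp add: is_graph_def)
  obtain R where R: "R \<subseteq> verts G"
    "card R = card (verts F) \<and> clique R (edges G) \<or> card R = card (verts F') \<and> indep R (edges G)"
    using r[OF finG G(2)] by blast
  from R(2) have "contains_induced G F \<or> contains_induced G F'"
  proof (elim disjE conjE)
    assume "card R = card (verts F)" "clique R (edges G)"
    with bij[OF F(2) R(1)] obtain h where h: "bij_betw h (verts F) R" by blast
    have "contains_induced G F"
    proof (rule contains_inducedI[OF F(2) gG h R(1)])
      fix u v assume "u \<in> verts F" "v \<in> verts F" "u \<noteq> v"
      then show "{u, v} \<in> edges F \<longleftrightarrow> {h u, h v} \<in> edges G"
        using F(3) \<open>clique R (edges G)\<close> h by (auto simp: clique_def bij_betw_def inj_on_eq_iff)
    qed
    then show ?thesis ..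
  next
    assume "card R = card (verts F')" "indep R (edges G)"
    with bij[OF F'(2) R(1)] obtain h where h: "bij_betw h (verts F') R" by blast
    have "contains_induced G F'"
    proof (rule contains_inducedI[OF F'(2) gG h R(1)])
      fix u v assume "u \<in> verts F'" "v \<in> verts F'" "u \<noteq> v"
      then show "{u, v} \<in> edges F' \<longleftrightarrow> {h u, h v} \<in> edges G"
        using F'(3) \<open>indep R (edges G)\<close> h by (auto simp: indep_def bij_betw_def inj_on_eq_iff)
    qed
    then show ?thesis ..
  qed
  then show False using G(1) F(1) F'(1) by (auto simp: Forb_def)
qed

text \<open>For \<open>\<chi> \<ge> 2\<close> the gray clique on \<open>\<chi> - 1\<close> white vertices serves. Otherwise \<open>\<F>\<close> has an edgeless member, hence
  by non-triviality no complete one, and complete graphs are the only ones that map to a single black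
  vertex.\<close>

lemma exists_maximal_white:
  assumes \<F>: "\<And>F. F \<in> \<F> \<Longrightarrow> is_graph F" "\<F> \<noteq> {}" "nontrivial_property (Forb \<F>)"
  shows "\<exists>K\<in>CRGs0 \<F>. card (VW K) = family_chromatic_number \<F> - 1"
proof (cases "family_chromatic_number \<F> \<ge> 2")
  case True
  then show ?thesis
    by (intro bexI[of _ "gray_clique (family_chromatic_number \<F> - 1)"] gray_clique_in_CRGs0) auto
next
  case False
  obtain F' where F': "F' \<in> \<F>" "chromatic_number F' = family_chromatic_number \<F>"
    using family_chromatic_number_attained[OF \<F>(2)] by blast
  then obtain c where c: "proper_colouring F' (family_chromatic_number \<F>) c"
    using chromatic_number_colouring[OF \<F>(1)[OF F'(1)]] by auto
  have edgeless: "{u, v} \<notin> edges F'" if "u \<in> verts F'" "v \<in> verts F'" for u v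
  proof
    assume "{u, v} \<in> edges F'"
    then have "c u \<noteq> c v" using c that by (simp add: proper_colouring_def)
    moreover have "c u < family_chromatic_number \<F>" "c v < family_chromatic_number \<F>"
      using c that by (auto simp: proper_colouring_def)
    ultimately show False using False by linarith
  qed
  define K :: "nat crg" where "K = \<lparr>VB = {0}, VW = {}, EB = {}, EW = {}, EG = {}\<rparr>"
  have "is_crg K" by (simp add: K_def is_crg_def crg_verts_def nsets_eq_empty)
  moreover have "\<not> F \<mapsto> K" if F: "F \<in> \<F>" for F
  proof
    assume "F \<mapsto> K"
    then have "{u, v} \<in> edges F" if "u \<in> verts F" "v \<in> verts F" "u \<noteq> v" for u v
    proof (rule maps_toE)
      fix \<phi>
      assume "\<And>u v. u \<in> verts F \<Longrightarrow> v \<in> verts F \<Longrightarrow> u \<noteq> v \<Longrightarrow> {u, v} \<notin> edges F \<Longrightarrow>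
        \<phi> u = \<phi> v \<and> \<phi> u \<in> VW K \<or> {\<phi> u, \<phi> v} \<in> EW K \<or> {\<phi> u, \<phi> v} \<in> EG K"
      from this[OF that] show ?thesis by (auto simp: K_def)
    qed
    from clique_edgeless_trivial[OF F \<F>(1)[OF F] this F'(1) \<F>(1)[OF F'(1)] edgeless] \<F>(3)
    show False by blast
  qed
  ultimately show ?thesis
    using False by (intro bexI[of _ K]) (auto simp: K_def CRGs0_def CRGs_def zero_core_def)
qed


section \<open>Repairing a graph along a random map to a CRG\<close>

text \<open>A black vertex \<open>x\<close> is recorded as the singleton \<open>{x}\<close>, so that one membership test on the image of a
  pair under a map to \<open>K\<close> covers pairs that are sent to an edge as well as pairs that are collapsed to a
  vertex; likewise for white.\<close>

definition black_pairs :: "'a crg \<Rightarrow> 'a set set" where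
  "black_pairs K = EB K \<union> (\<lambda>x. {x}) ` VB K"

definition white_pairs :: "'a crg \<Rightarrow> 'a set set" where
  "white_pairs K = EW K \<union> (\<lambda>x. {x}) ` VW K"

lemma crg_matrix_pairs:
  "is_crg K \<Longrightarrow> crg_matrix K p x y
    = p * of_bool ({x, y} \<in> white_pairs K) + (1 - p) * of_bool ({x, y} \<in> black_pairs K)"
  using crg_disjoint(1)[of K x] crg_disjoint(2)[of K "{x, y}"] crg_no_loop[of K x]
  by (cases "x = y") (auto simp: crg_matrix_def black_pairs_def white_pairs_def)

text \<open>The graph obtained from \<open>G\<close> by the fewest changes that make \<open>\<phi>\<close> respect the colours of \<open>K\<close>.\<close>

definition repaired :: "'a graph \<Rightarrow> 'b crg \<Rightarrow> ('a \<Rightarrow> 'b) \<Rightarrow> 'a graph" where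
  "repaired G K \<phi> = \<lparr>verts = verts G,
     edges = {e\<in>[verts G]\<^bsup>2\<^esup>. \<phi> ` e \<in> black_pairs K \<or> e \<in> edges G \<and> \<phi> ` e \<notin> white_pairs K}\<rparr>"

lemma pair_colour_cases:
  assumes "is_crg K" "x \<in> crg_verts K" "y \<in> crg_verts K"
  shows "{x, y} \<notin> white_pairs K \<Longrightarrow> x = y \<and> x \<in> VB K \<or> {x, y} \<in> EB K \<or> {x, y} \<in> EG K"
    and "{x, y} \<notin> black_pairs K \<Longrightarrow> x = y \<and> x \<in> VW K \<or> {x, y} \<in> EW K \<or> {x, y} \<in> EG K"
    and "{x, y} \<in> black_pairs K \<Longrightarrow> {x, y} \<notin> white_pairs K"
  using crg_edge_cases[OF assms] crg_disjoint[OF assms(1)] crg_no_loop[OF assms(1), of x] assms(2)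
  by (cases "x = y"; auto simp: black_pairs_def white_pairs_def crg_verts_def)+

text \<open>If \<open>f\<close> embeds \<open>F\<close> as an induced subgraph of the repaired graph, then \<open>\<phi> \<circ> f\<close> is a map \<open>F \<mapsto> K\<close>.\<close>

lemma repaired_in_Forb:
  assumes K: "K \<in> CRGs \<F>" and \<F>: "\<And>F. F \<in> \<F> \<Longrightarrow> is_graph F"
    and G: "is_graph G" and \<phi>: "\<phi> ` verts G \<subseteq> crg_verts K"
  shows "repaired G K \<phi> \<in> Forb \<F>"
proof -
  let ?H = "repaired G K \<phi>"
  have crg: "is_crg K" using K by (simp add: CRGs_def)
  have H: "is_graph ?H" using G by (auto simp: is_graph_def repaired_def)
  have "\<not> contains_induced ?H F" if F: "F \<in> \<F>" for F
  proof
    assume "contains_induced ?H F"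
    then obtain f where inj: "inj_on f (verts F)" and fV: "f ` verts F \<subseteq> verts ?H"
      and f: "\<forall>u\<in>verts F. \<forall>v\<in>verts F. {u, v} \<in> edges F \<longleftrightarrow> {f u, f v} \<in> edges ?H"
      unfolding contains_induced_def by blast
    have fG: "f u \<in> verts G" "\<phi> (f u) \<in> crg_verts K" if "u \<in> verts F" for u
      using that fV \<phi> by (auto simp: repaired_def)
    have "F \<mapsto> K"
    proof (rule maps_toI[where \<phi>="\<lambda>u. \<phi> (f u)"])
      fix u v assume uv: "u \<in> verts F" "v \<in> verts F" "{u, v} \<in> edges F"
      then have "{f u, f v} \<in> edges ?H" using f by blast
      then have "{\<phi> (f u), \<phi> (f v)} \<in> black_pairs K \<or> {\<phi> (f u), \<phi> (f v)} \<notin> white_pairs K"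
        by (auto simp: repaired_def)
      then show "\<phi> (f u) = \<phi> (f v) \<and> \<phi> (f u) \<in> VB K \<or> {\<phi> (f u), \<phi> (f v)} \<in> EB K \<or> {\<phi> (f u), \<phi> (f v)} \<in> EG K"
        using pair_colour_cases(1,3)[OF crg fG(2)[OF uv(1)] fG(2)[OF uv(2)]] by blast
    next
      fix u v assume uv: "u \<in> verts F" "v \<in> verts F" "u \<noteq> v" "{u, v} \<notin> edges F"
      then have "{f u, f v} \<notin> edges ?H" using f by blast
      moreover have "{f u, f v} \<in> [verts G]\<^bsup>2\<^esup>" using uv fG inj by (simp add: inj_on_eq_iff)
      ultimately have "{\<phi> (f u), \<phi> (f v)} \<notin> black_pairs K" by (simp add: repaired_def)
      then show "\<phi> (f u) = \<phi> (f v) \<and> \<phi> (f u) \<in> VW K \<or> {\<phi> (f u), \<phi> (f v)} \<in> EW K \<or> {\<phi> (f u), \<phi> (f v)} \<in> EG K"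
        by (rule pair_colour_cases(2)[OF crg fG(2)[OF uv(1)] fG(2)[OF uv(2)]])
    qed (rule fG)
    then show False using K F by (simp add: CRGs_def)
  qed
  then show ?thesis using H by (simp add: Forb_def)
qed

lemma sum_PiE_insert:
  assumes "x \<notin> S"
  shows "(\<Sum>\<phi>\<in>Pi\<^sub>E (insert x S) (\<lambda>_. X). f \<phi>) = (\<Sum>y\<in>X. \<Sum>\<psi>\<in>Pi\<^sub>E S (\<lambda>_. X). f (\<psi>(x := y)))"
  unfolding PiE_insert_eq sum.cartesian_product
  by (subst sum.reindex[OF inj_combinator[OF assms, of "\<lambda>_. X"]]) (simp add: case_prod_unfold)

text \<open>The product weights \<open>\<Prod>w\<in>S. \<mu> (\<phi> w)\<close> are the distribution of a map that chooses the image of each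
  point independently according to \<open>\<mu>\<close>: they sum to \<open>1\<close>, and the values at two different points have the
  product distribution.\<close>

lemma sum_PiE_prod:
  fixes \<mu> :: "'a \<Rightarrow> real"
  assumes "finite S" "sum \<mu> X = 1"
  shows "(\<Sum>\<phi>\<in>Pi\<^sub>E S (\<lambda>_. X). \<Prod>w\<in>S. \<mu> (\<phi> w)) = 1"
  using assms(1)
proof induction
  case (insert x S)
  have "(\<Prod>w\<in>insert x S. \<mu> ((\<psi>(x := y)) w)) = \<mu> y * (\<Prod>w\<in>S. \<mu> (\<psi> w))" for \<psi> y
  proof -
    have "(\<Prod>w\<in>S. \<mu> ((\<psi>(x := y)) w)) = (\<Prod>w\<in>S. \<mu> (\<psi> w))"
      using insert.hyps by (intro prod.cong) auto
    then show ?thesis using insert.hyps by simp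
  qed
  then show ?case
    unfolding sum_PiE_insert[OF insert.hyps(2)]
    by (simp add: insert.IH assms(2) flip: sum_distrib_left)
qed simp

lemma sum_PiE_pair:
  fixes \<mu> :: "'a \<Rightarrow> real"
  assumes S: "finite S" "sum \<mu> X = 1" and uv: "u \<in> S" "v \<in> S" "u \<noteq> v"
  shows "(\<Sum>\<phi>\<in>Pi\<^sub>E S (\<lambda>_. X). (\<Prod>w\<in>S. \<mu> (\<phi> w)) * h (\<phi> u) (\<phi> v)) = (\<Sum>x\<in>X. \<Sum>y\<in>X. \<mu> x * \<mu> y * h x y)"
proof -
  define R where "R = S - {u, v}"
  have S_eq: "S = insert u (insert v R)" and R: "finite R" "u \<notin> insert v R" "v \<notin> R"
    using S uv by (auto simp: R_def)
  have "(\<Prod>w\<in>insert u (insert v R). \<mu> ((\<psi>(v := y, u := x)) w)) = \<mu> x * \<mu> y * (\<Prod>w\<in>R. \<mu> (\<psi> w))"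
    for \<psi> x y
  proof -
    have "(\<Prod>w\<in>R. \<mu> ((\<psi>(v := y, u := x)) w)) = (\<Prod>w\<in>R. \<mu> (\<psi> w))"
      using R by (intro prod.cong) auto
    then show ?thesis using R uv(3) by simp
  qed
  then have "(\<Sum>\<phi>\<in>Pi\<^sub>E S (\<lambda>_. X). (\<Prod>w\<in>S. \<mu> (\<phi> w)) * h (\<phi> u) (\<phi> v))
      = (\<Sum>x\<in>X. \<Sum>y\<in>X. \<Sum>\<psi>\<in>Pi\<^sub>E R (\<lambda>_. X). (\<mu> x * \<mu> y * h x y) * (\<Prod>w\<in>R. \<mu> (\<psi> w)))"
    unfolding S_eq sum_PiE_insert[OF R(2)] sum_PiE_insert[OF R(3)]
    using uv(3) by (intro sum.cong refl) (simp add: mult_ac)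
  also have "\<dots> = (\<Sum>x\<in>X. \<Sum>y\<in>X. \<mu> x * \<mu> y * h x y)"
    by (simp add: sum_PiE_prod[OF R(1) S(2)] flip: sum_distrib_left)
  finally show ?thesis .
qed

lemma exists_le_average:
  fixes w f :: "'a \<Rightarrow> real"
  assumes "finite A" "\<And>x. x \<in> A \<Longrightarrow> 0 \<le> w x" "sum w A = 1"
  shows "\<exists>x\<in>A. f x \<le> (\<Sum>x\<in>A. w x * f x)"
proof (rule ccontr)
  let ?m = "\<Sum>x\<in>A. w x * f x"
  assume "\<not> ?thesis"
  then have gt: "?m < f x" if "x \<in> A" for x using that by (simp add: not_le)
  obtain x where x: "x \<in> A" "w x \<noteq> 0" using assms(3) by (metis sum.neutral zero_neq_one)
  have "(\<Sum>x\<in>A. w x * ?m) < ?m"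
    using assms(1) x assms(2)[OF x(1)] gt[OF x(1)]
    by (intro sum_strict_mono_ex1)
      (auto intro!: mult_left_mono less_imp_le[OF gt] assms(2) bexI[of _ x])
  moreover have "(\<Sum>x\<in>A. w x * ?m) = ?m"
    using assms(3) by (simp flip: sum_distrib_right)
  ultimately show False by simp
qed

text \<open>For the random map with product weights, an edge of \<open>G\<close> has to be deleted with probability \<open>W\<close> and a
  non-edge has to be added with probability \<open>B\<close>. The right-hand side is thus the expected number of
  changes, and some map does at least as well as the average.\<close>

lemma random_repair:
  fixes G :: "'v graph" and K :: "'k crg"
  assumes G: "is_graph G" and \<mu>: "\<mu> \<in> prob_masses (crg_verts K)" and crg: "is_crg K"
  defines "X \<equiv> crg_verts K" and "C \<equiv> real (card (verts G) choose 2)" and "e \<equiv> real (card (edges G))"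
  defines "W \<equiv> (\<Sum>x\<in>X. \<Sum>y\<in>X. \<mu> x * \<mu> y * of_bool ({x, y} \<in> white_pairs K))"
    and "B \<equiv> (\<Sum>x\<in>X. \<Sum>y\<in>X. \<mu> x * \<mu> y * of_bool ({x, y} \<in> black_pairs K))"
  shows "\<exists>\<phi>. \<phi> ` verts G \<subseteq> X \<and>
    real (card (sym_diff (edges G) (edges (repaired G K \<phi>)))) \<le> e * W + (C - e) * B"
proof -
  let ?V = "verts G" and ?P = "[verts G]\<^bsup>2\<^esup>"
  let ?\<Phi> = "Pi\<^sub>E ?V (\<lambda>_. X)" and ?w = "\<lambda>\<phi>. \<Prod>v\<in>?V. \<mu> (\<phi> v)"
  let ?c = "\<lambda>\<phi> a. of_bool (if a \<in> edges G then \<phi> ` a \<in> white_pairs K else \<phi> ` a \<in> black_pairs K) :: real"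
  have fin: "finite ?V" "finite ?P" "finite X" "edges G \<subseteq> ?P"
    using G crg_verts_finite[OF crg] finite_imp_finite_nsets[of ?V 2] by (simp_all add: is_graph_def X_def)
  have sum1: "sum \<mu> X = 1" and \<mu>_nonneg: "\<And>x. x \<in> X \<Longrightarrow> 0 \<le> \<mu> x"
    using \<mu> by (auto simp: prob_masses_def X_def)
  have "\<exists>\<phi>\<in>?\<Phi>. (\<Sum>a\<in>?P. ?c \<phi> a) \<le> (\<Sum>\<phi>\<in>?\<Phi>. ?w \<phi> * (\<Sum>a\<in>?P. ?c \<phi> a))"
    using fin \<mu>_nonneg
    by (intro exists_le_average finite_PiE sum_PiE_prod sum1 prod_nonneg) (auto simp: PiE_iff)
  then obtain \<phi> where \<phi>: "\<phi> \<in> ?\<Phi>" "(\<Sum>a\<in>?P. ?c \<phi> a) \<le> (\<Sum>\<phi>\<in>?\<Phi>. ?w \<phi> * (\<Sum>a\<in>?P. ?c \<phi> a))" by blast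
  have marginal: "(\<Sum>\<phi>\<in>?\<Phi>. ?w \<phi> * ?c \<phi> a) = (if a \<in> edges G then W else B)" if a: "a \<in> ?P" for a
  proof -
    obtain u v where uv: "a = {u, v}" "u \<in> ?V" "v \<in> ?V" "u \<noteq> v" using a by (rule nsets2_E)
    show ?thesis
    proof (cases "a \<in> edges G")
      case True
      then show ?thesis
        using sum_PiE_pair[OF fin(1) sum1 uv(2-4), where h="\<lambda>x y. of_bool ({x, y} \<in> white_pairs K)"]
        by (simp add: uv(1) W_def)
    next
      case False
      then show ?thesis
        using sum_PiE_pair[OF fin(1) sum1 uv(2-4), where h="\<lambda>x y. of_bool ({x, y} \<in> black_pairs K)"]
        by (simp add: uv(1) B_def)
    qed
  qed
  have "(\<Sum>\<phi>\<in>?\<Phi>. ?w \<phi> * (\<Sum>a\<in>?P. ?c \<phi> a)) = (\<Sum>a\<in>?P. \<Sum>\<phi>\<in>?\<Phi>. ?w \<phi> * ?c \<phi> a)"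
    unfolding sum_distrib_left by (rule sum.swap)
  also have "\<dots> = (\<Sum>a\<in>?P. if a \<in> edges G then W else B)"
    by (intro sum.cong refl marginal)
  also have "\<dots> = (\<Sum>a\<in>edges G. W) + (\<Sum>a\<in>?P - edges G. B)"
    using fin by (subst sum.subset_diff[OF fin(4)]) (auto intro!: arg_cong2[where f="(+)"] sum.cong)
  also have "\<dots> = e * W + (C - e) * B"
    using fin card_mono[OF fin(2,4)]
    by (simp add: e_def C_def card_Diff_subset finite_subset[OF fin(4)] of_nat_diff)
  finally have avg: "(\<Sum>a\<in>?P. ?c \<phi> a) \<le> e * W + (C - e) * B" using \<phi>(2) by simp
  let ?bad = "{a\<in>?P. if a \<in> edges G then \<phi> ` a \<in> white_pairs K else \<phi> ` a \<in> black_pairs K}"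
  have "sym_diff (edges G) (edges (repaired G K \<phi>)) \<subseteq> ?bad"
    using fin(4) by (auto simp: repaired_def)
  then have "card (sym_diff (edges G) (edges (repaired G K \<phi>))) \<le> card ?bad"
    using fin(2) by (intro card_mono) auto
  moreover have "real (card ?bad) = (\<Sum>a\<in>?P. ?c \<phi> a)"
    using fin(2) by (simp only: sum_of_bool_eq Int_def mem_Collect_eq)
  ultimately have "real (card (sym_diff (edges G) (edges (repaired G K \<phi>)))) \<le> e * W + (C - e) * B"
    using avg by linarith
  then show ?thesis using \<phi>(1) by (intro exI[of _ \<phi>]) (auto simp: PiE_iff)
qed


section \<open>Bounds for the edit distance function\<close>

text \<open>The distances from a graph on \<open>n\<close> vertices form a finite set that depends on \<open>n\<close> alone. For this reason
  the minimum in \<open>dist_property\<close>, and the maximum over infinitely many graphs in \<open>max_dist\<close>, range over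
  finite sets.\<close>

lemma graph_dist_bounds:
  assumes "is_graph G" "is_graph H" "verts H = verts G"
  shows "graph_dist G H \<in> (\<lambda>k. real k / real (card (verts G) choose 2)) ` {..card (verts G) choose 2}"
proof -
  have "finite ([verts G]\<^bsup>2\<^esup>)" using assms(1) by (simp add: is_graph_def finite_imp_finite_nsets)
  moreover have "sym_diff (edges G) (edges H) \<subseteq> [verts G]\<^bsup>2\<^esup>"
    using assms unfolding is_graph_def by auto
  ultimately have "card (sym_diff (edges G) (edges H)) \<le> card (verts G) choose 2"
    using card_mono[of "[verts G]\<^bsup>2\<^esup>"] by simp
  then show ?thesis unfolding graph_dist_def by blast
qed

lemma finite_dist_set:
  assumes "is_graph G"
  shows "finite {graph_dist G H |H. H \<in> Forb \<F> \<and> verts H = verts G}"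
  by (rule finite_subset[OF _ finite_imageI[OF finite_atMost]])
    (use graph_dist_bounds[OF assms] in \<open>auto simp: Forb_def\<close>)

lemma dist_property_le:
  assumes "is_graph G" "H \<in> Forb \<F>" "verts H = verts G"
  shows "dist_property G (Forb \<F>) \<le> graph_dist G H"
  unfolding dist_property_def using assms by (intro Min_le finite_dist_set) auto

definition sized_graphs :: "real \<Rightarrow> nat \<Rightarrow> nat graph set" where
  "sized_graphs p n = {G :: nat graph. is_graph G \<and> card (verts G) = n \<and>
  int (card (edges G)) = \<lfloor>p * real (n choose 2)\<rfloor>}"

lemma max_dist_eq: "max_dist \<H> p n = Max ((\<lambda>G. dist_property G \<H>) ` sized_graphs p n)"
  unfolding max_dist_def sized_graphs_def by (rule arg_cong[where f=Max]) auto

lemma sized_graphs_nonempty: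
  assumes "0 \<le> p" "p \<le> 1"
  shows "sized_graphs p n \<noteq> {}"
proof -
  have nonneg: "0 \<le> p * real (n choose 2)" using assms by simp
  have "p * real (n choose 2) \<le> real (n choose 2)" using assms by (intro mult_left_le_one_le) auto
  then have "nat \<lfloor>p * real (n choose 2)\<rfloor> \<le> n choose 2" by linarith
  then have "nat \<lfloor>p * real (n choose 2)\<rfloor> \<le> card ([{..<n}]\<^bsup>2\<^esup>)" by simp
  then obtain E where E: "E \<subseteq> [{..<n}]\<^bsup>2\<^esup>" "card E = nat \<lfloor>p * real (n choose 2)\<rfloor>"
    by (rule obtain_subset_with_card_n)
  then have "\<lparr>verts = {..<n}, edges = E\<rparr> \<in> sized_graphs p n"
    using nonneg by (simp add: sized_graphs_def is_graph_def)
  then show ?thesis by blast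
qed

context
  fixes \<F> :: "nat graph set"
  assumes graphs: "\<And>F. F \<in> \<F> \<Longrightarrow> is_graph F" and CRGs_nonempty: "CRGs \<F> \<noteq> {}"
begin

lemma dist_property_attained:
  assumes G: "is_graph G"
  obtains H where "H \<in> Forb \<F>" "verts H = verts G" "dist_property G (Forb \<F>) = graph_dist G H"
proof -
  obtain K where K: "K \<in> CRGs \<F>" using CRGs_nonempty by blast
  then obtain x where "x \<in> crg_verts K" using crg_verts_nonempty[of K] by (auto simp: CRGs_def)
  then have "repaired G K (\<lambda>_. x) \<in> Forb \<F>"
    by (intro repaired_in_Forb K graphs G) auto
  then have "{graph_dist G H |H. H \<in> Forb \<F> \<and> verts H = verts G} \<noteq> {}"
    by (auto simp: repaired_def)
  from Min_in[OF finite_dist_set[OF G] this] show ?thesis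
    using that unfolding dist_property_def by blast
qed

lemma dist_property_bounds:
  assumes "is_graph G"
  shows "dist_property G (Forb \<F>) \<in> (\<lambda>k. real k / real (card (verts G) choose 2)) ` {..card (verts G) choose 2}"
  using dist_property_attained[OF assms] graph_dist_bounds[OF assms]
  by (metis (no_types, lifting) Forb_def mem_Collect_eq)

lemma finite_max_dist_set: "finite ((\<lambda>G. dist_property G (Forb \<F>)) ` sized_graphs p n)"
proof (rule finite_subset)
  show "(\<lambda>G. dist_property G (Forb \<F>)) ` sized_graphs p n
      \<subseteq> (\<lambda>k. real k / real (n choose 2)) ` {..n choose 2}"
    using dist_property_bounds unfolding sized_graphs_def by blast
qed simp

lemma max_dist_le:
  assumes "0 \<le> p" "p \<le> 1" "\<And>G. G \<in> sized_graphs p n \<Longrightarrow> dist_property G (Forb \<F>) \<le> c"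
  shows "max_dist (Forb \<F>) p n \<le> c"
  unfolding max_dist_eq using assms sized_graphs_nonempty[OF assms(1,2)]
  by (subst Max_le_iff[OF finite_max_dist_set]) auto

lemma le_max_dist: "G \<in> sized_graphs p n \<Longrightarrow> dist_property G (Forb \<F>) \<le> max_dist (Forb \<F>) p n"
  unfolding max_dist_eq by (intro Max_ge finite_max_dist_set imageI)

lemma max_dist_bounds:
  assumes "0 \<le> p" "p \<le> 1"
  shows "0 \<le> max_dist (Forb \<F>) p n" "max_dist (Forb \<F>) p n \<le> 1"
proof -
  have *: "0 \<le> dist_property G (Forb \<F>)" "dist_property G (Forb \<F>) \<le> 1" if "G \<in> sized_graphs p n" for G
    using dist_property_bounds[of G] that by (auto simp: sized_graphs_def divide_le_eq_1)
  show "max_dist (Forb \<F>) p n \<le> 1" by (intro max_dist_le assms *)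
  obtain G where G: "G \<in> sized_graphs p n" using sized_graphs_nonempty[OF assms] by blast
  show "0 \<le> max_dist (Forb \<F>) p n" using *(1)[OF G] le_max_dist[OF G] by linarith
qed

text \<open>With \<open>C = n choose 2\<close> and \<open>e\<close> edges, a random repair costs at most \<open>e W + (C - e) B\<close> on average, and
  \<open>p W + (1 - p) B\<close> is the energy of \<open>\<mu>\<close>. Rounding in \<open>e = \<lfloor>p C\<rfloor>\<close> costs at most one further change, hence
  an error \<open>1/C\<close>, which is at most \<open>1/n\<close> once \<open>n \<ge> 3\<close>.\<close>

lemma max_dist_le_energy:
  assumes p: "0 \<le> p" "p \<le> 1" and K: "K \<in> CRGs \<F>" and \<mu>: "\<mu> \<in> prob_masses (crg_verts K)" and n: "3 \<le> n"
  shows "max_dist (Forb \<F>) p n \<le> bform (crg_verts K) (crg_matrix K p) \<mu> \<mu> + 1 / n"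
proof (rule max_dist_le[OF p])
  fix G assume "G \<in> sized_graphs p n"
  then have G: "is_graph G" "card (verts G) = n" "int (card (edges G)) = \<lfloor>p * real (n choose 2)\<rfloor>"
    by (auto simp: sized_graphs_def)
  have crg: "is_crg K" using K by (simp add: CRGs_def)
  let ?X = "crg_verts K"
  define C where "C = real (n choose 2)"
  define e where "e = real (card (edges G))"
  define W where "W = (\<Sum>x\<in>?X. \<Sum>y\<in>?X. \<mu> x * \<mu> y * of_bool ({x, y} \<in> white_pairs K))"
  define B where "B = (\<Sum>x\<in>?X. \<Sum>y\<in>?X. \<mu> x * \<mu> y * of_bool ({x, y} \<in> black_pairs K))"
  from random_repair[OF G(1) \<mu> crg] obtain \<phi> where \<phi>: "\<phi> ` verts G \<subseteq> ?X"
    "real (card (sym_diff (edges G) (edges (repaired G K \<phi>)))) \<le> e * W + (C - e) * B"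
    unfolding W_def B_def C_def e_def G(2) by blast
  have "n * 2 \<le> n * (n - 1)" using n by (intro mult_left_mono) auto
  then have "n * 2 div 2 \<le> n * (n - 1) div 2" by (rule div_le_mono)
  then have "n \<le> n choose 2" unfolding choose_two by simp
  then have C: "real n \<le> C" "0 < C" using n by (auto simp: C_def)
  have \<mu>_nonneg: "\<And>x. x \<in> ?X \<Longrightarrow> 0 \<le> \<mu> x" and \<mu>_sum: "sum \<mu> ?X = 1"
    using \<mu> by (auto simp: prob_masses_def)
  have W: "0 \<le> W" and B: "0 \<le> B"
    unfolding W_def B_def by (auto intro!: sum_nonneg mult_nonneg_nonneg \<mu>_nonneg)
  have "B \<le> (\<Sum>x\<in>?X. \<Sum>y\<in>?X. \<mu> x * \<mu> y)"
    unfolding B_def by (intro sum_mono) (auto intro!: mult_nonneg_nonneg \<mu>_nonneg)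
  also have "\<dots> = 1" by (simp add: \<mu>_sum flip: sum_distrib_left)
  finally have B1: "B \<le> 1" .
  have energy: "bform ?X (crg_matrix K p) \<mu> \<mu> = p * W + (1 - p) * B"
    unfolding bform_def W_def B_def sum_distrib_left sum.distrib[symmetric]
    by (intro sum.cong refl) (simp only: crg_matrix_pairs[OF crg], simp add: algebra_simps)
  have e: "e \<le> p * C" "p * C - 1 \<le> e" unfolding e_def C_def using G(3) by linarith+
  have "e * W + (C - e) * B \<le> (p * C) * W + ((1 - p) * C + 1) * B"
    using e W B by (intro add_mono mult_right_mono) (auto simp: algebra_simps)
  also have "\<dots> \<le> C * (p * W + (1 - p) * B) + 1"
    using B1 by (simp add: algebra_simps)
  finally have "graph_dist G (repaired G K \<phi>) \<le> (C * (p * W + (1 - p) * B) + 1) / C"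
    unfolding graph_dist_def G(2) C_def[symmetric] using \<phi>(2) C(2) by (intro divide_right_mono) auto
  also have "\<dots> = p * W + (1 - p) * B + 1 / C" using C(2) by (simp add: add_divide_distrib)
  also have "\<dots> \<le> p * W + (1 - p) * B + 1 / n"
    using C n by (intro add_left_mono divide_left_mono) auto
  finally have "graph_dist G (repaired G K \<phi>) \<le> bform ?X (crg_matrix K p) \<mu> \<mu> + 1 / n"
    by (simp add: energy)
  moreover have "dist_property G (Forb \<F>) \<le> graph_dist G (repaired G K \<phi>)"
    using repaired_in_Forb[OF K graphs G(1) \<phi>(1)]
    by (intro dist_property_le G) (auto simp: repaired_def)
  ultimately show "dist_property G (Forb \<F>) \<le> bform ?X (crg_matrix K p) \<mu> \<mu> + 1 / n" by linarith
qed

text \<open>Deleting all edges of \<open>G\<close> changes a proportion of at most \<open>p\<close> of the pairs and leads to an edgeless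
  graph, which is a competitor for \<open>max_dist\<close> at \<open>0\<close>.\<close>

lemma max_dist_le_at_0:
  assumes p: "0 \<le> p" "p \<le> 1"
  shows "max_dist (Forb \<F>) p n \<le> max_dist (Forb \<F>) 0 n + p"
proof (rule max_dist_le[OF p])
  fix G assume "G \<in> sized_graphs p n"
  then have G: "is_graph G" "card (verts G) = n" "int (card (edges G)) = \<lfloor>p * real (n choose 2)\<rfloor>"
    by (auto simp: sized_graphs_def)
  let ?C = "real (n choose 2)"
  let ?G0 = "\<lparr>verts = verts G, edges = {}\<rparr> :: nat graph"
  have G0: "?G0 \<in> sized_graphs 0 n" "is_graph ?G0"
    using G by (auto simp: sized_graphs_def is_graph_def)
  obtain H where H: "H \<in> Forb \<F>" "verts H = verts G" "dist_property ?G0 (Forb \<F>) = graph_dist ?G0 H"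
    using dist_property_attained[OF G0(2)] by auto
  have fin: "finite (edges G)" "finite (edges H)"
    using G(1) H by (auto simp: is_graph_def Forb_def intro: finite_subset finite_imp_finite_nsets)
  have "card (sym_diff (edges G) (edges H)) \<le> card (edges G \<union> edges H)"
    using fin by (intro card_mono) auto
  also have "\<dots> \<le> card (edges G) + card (edges H)" by (rule card_Un_le)
  finally have "graph_dist G H \<le> real (card (edges G) + card (edges H)) / ?C"
    unfolding graph_dist_def G(2) by (intro divide_right_mono) auto
  also have "\<dots> = graph_dist ?G0 H + card (edges G) / ?C"
    by (simp add: graph_dist_def G(2) add_divide_distrib)
  also have "real (card (edges G)) \<le> p * ?C" using G(3) by linarith
  then have "card (edges G) / ?C \<le> p"
    using p(1) by (cases "n choose 2 = 0") (auto simp: divide_le_eq)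
  finally have "graph_dist G H \<le> graph_dist ?G0 H + p" by simp
  then show "dist_property G (Forb \<F>) \<le> max_dist (Forb \<F>) 0 n + p"
    using dist_property_le[OF G(1) H(1,2)] le_max_dist[OF G0(1)] H(3) by linarith
qed

end

text \<open>The bounds on \<open>a\<close> and \<open>b\<close> keep both limits superior finite, where \<open>real_of_ereal\<close> is monotone.\<close>

lemma real_limsup_le:
  fixes a b e :: "nat \<Rightarrow> real"
  assumes bounds: "\<And>n. 0 \<le> a n" "\<And>n. 0 \<le> b n" "\<And>n. b n \<le> 1"
    and le: "eventually (\<lambda>n. a n \<le> b n + e n) sequentially" and e: "e \<longlonglongrightarrow> c"
  shows "real_of_ereal (limsup a) \<le> real_of_ereal (limsup b) + c"
proof -
  have "0 \<le> limsup b" using bounds(2) by (intro le_Limsup) auto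
  moreover have "limsup b \<le> 1" using bounds(3) by (intro Limsup_bounded) auto
  ultimately obtain L where L: "limsup b = ereal L" by (cases "limsup b") auto
  have "limsup a \<le> limsup (\<lambda>n. ereal (b n) + ereal (e n))"
    using le by (intro Limsup_mono) (auto elim: eventually_mono)
  also have "\<dots> \<le> limsup b + limsup e" by (rule ereal_limsup_add_mono)
  also have "limsup e = ereal c" using e by (intro lim_imp_Limsup) auto
  finally have "limsup a \<le> ereal (L + c)" by (simp add: L)
  moreover have "0 \<le> limsup a" using bounds(1) by (intro le_Limsup) auto
  ultimately show ?thesis by (cases "limsup a") (auto simp: L)
qed

lemma ed_le_g:
  assumes \<F>: "\<And>F. F \<in> \<F> \<Longrightarrow> is_graph F" and p: "0 \<le> p" "p \<le> 1" and K: "K \<in> CRGs \<F>"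
  shows "ed (Forb \<F>) p \<le> g K p"
proof (rule g_greatest)
  show "is_crg K" using K by (simp add: CRGs_def)
  fix \<mu> assume \<mu>: "\<mu> \<in> prob_masses (crg_verts K)"
  let ?E = "bform (crg_verts K) (crg_matrix K p) \<mu> \<mu>"
  have ne: "CRGs \<F> \<noteq> {}" using K by blast
  have "real_of_ereal (limsup (max_dist (Forb \<F>) p)) \<le> real_of_ereal (limsup (\<lambda>n::nat. 0::real)) + (?E + 0)"
  proof (rule real_limsup_le)
    show "(\<lambda>n. ?E + 1 / real n) \<longlonglongrightarrow> ?E + 0" by (intro tendsto_intros lim_1_over_n)
    show "eventually (\<lambda>n. max_dist (Forb \<F>) p n \<le> 0 + (?E + 1 / real n)) sequentially"
      by (rule eventually_mono[OF eventually_ge_at_top[of 3]])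
        (use max_dist_le_energy[OF \<F> ne p K \<mu>] in simp)
  qed (auto intro: max_dist_bounds[OF \<F> ne p])
  then show "ed (Forb \<F>) p \<le> ?E" by (simp add: ed_def Limsup_const)
qed

lemma ed_le_ed_0:
  assumes \<F>: "\<And>F. F \<in> \<F> \<Longrightarrow> is_graph F" "CRGs \<F> \<noteq> {}" and p: "0 \<le> p" "p \<le> 1"
  shows "ed (Forb \<F>) p \<le> ed (Forb \<F>) 0 + p"
  unfolding ed_def
  by (rule real_limsup_le[where e="\<lambda>_. p"])
    (auto intro!: always_eventually max_dist_bounds[OF \<F>] p max_dist_le_at_0[OF \<F> p])


section \<open>Regularity at \<open>0\<close>\<close>

text \<open>Every matrix entry at \<open>0\<close> exceeds the corresponding entry at \<open>p\<close> by at most \<open>p\<close>.\<close>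

lemma g_0_le:
  assumes K: "is_crg K" and p: "0 \<le> p" "p \<le> 1"
  shows "g K 0 \<le> g K p + p"
proof -
  have "g K 0 - p \<le> g K p"
  proof (rule g_greatest[OF K])
    fix \<mu> assume \<mu>: "\<mu> \<in> prob_masses (crg_verts K)"
    let ?X = "crg_verts K"
    have "bform ?X (crg_matrix K 0) \<mu> \<mu> \<le> (\<Sum>x\<in>?X. \<Sum>y\<in>?X. \<mu> x * crg_matrix K p x y * \<mu> y + p * (\<mu> x * \<mu> y))"
      unfolding bform_def
    proof (intro sum_mono)
      fix x y assume "x \<in> ?X" "y \<in> ?X"
      then have "0 \<le> \<mu> x * \<mu> y" using \<mu> by (auto simp: prob_masses_def)
      moreover have "(if a then 0 else if b then 1 - 0 else 0) \<le> (if a then p else if b then 1 - p else 0) + p"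
        for a b using p by simp
      then have "crg_matrix K 0 x y \<le> crg_matrix K p x y + p" unfolding crg_matrix_def .
      ultimately have "(\<mu> x * \<mu> y) * crg_matrix K 0 x y \<le> (\<mu> x * \<mu> y) * (crg_matrix K p x y + p)"
        by (intro mult_left_mono)
      then show "\<mu> x * crg_matrix K 0 x y * \<mu> y \<le> \<mu> x * crg_matrix K p x y * \<mu> y + p * (\<mu> x * \<mu> y)"
        by (simp add: algebra_simps)
    qed
    also have "\<dots> = bform ?X (crg_matrix K p) \<mu> \<mu> + p * (\<Sum>x\<in>?X. \<Sum>y\<in>?X. \<mu> x * \<mu> y)"
      by (simp add: bform_def sum.distrib sum_distrib_left)
    also have "(\<Sum>x\<in>?X. \<Sum>y\<in>?X. \<mu> x * \<mu> y) = 1"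
      using \<mu> by (simp add: prob_masses_def flip: sum_distrib_left)
    finally show "g K 0 - p \<le> bform ?X (crg_matrix K p) \<mu> \<mu>"
      using g_le[of 0 \<mu> K] \<mu> by simp
  qed
  then show ?thesis by simp
qed

text \<open>The bound \<open>\<delta>\<close> is chosen so small that \<open>2 p |K| \<le> 1\<close> holds for all \<open>p < \<delta>\<close> and all of the finitely many
  CRGs \<open>K\<close> that regularity provides.\<close>

lemma ed_eq_q_if_regular:
  assumes \<F>: "\<And>F. F \<in> \<F> \<Longrightarrow> is_graph F" "\<F> \<noteq> {}" "nontrivial_property (Forb \<F>)"
    and reg: "regular_point \<F> 0"
  shows "\<exists>\<delta>\<in>{0<..1/2}. \<forall>p\<in>{0<..<\<delta>}. ed (Forb \<F>) p = q \<F> p"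
proof -
  obtain \<epsilon> \<K> where \<epsilon>: "0 < \<epsilon>" and \<K>: "finite \<K>" "\<K> \<noteq> {}" "\<K> \<subseteq> CRGs \<F>"
    and ed: "\<forall>p \<in> {0 - \<epsilon><..<0 + \<epsilon>} \<inter> {0..1}. ed (Forb \<F>) p = (MIN K\<in>\<K>. g K p)"
    using reg unfolding regular_point_def by blast
  define N where "N = real (Max ((\<lambda>K. card (crg_verts K)) ` \<K>))"
  define \<delta> where "\<delta> = min \<epsilon> (min (1/2) (1 / (2 * N + 1)))"
  have N: "real (card (crg_verts K)) \<le> N" if "K \<in> \<K>" for K
    unfolding N_def using \<K>(1) that by simp
  have "0 \<le> N" by (simp add: N_def)
  then have "0 < 1 / (2 * N + 1)" by simp
  then have \<delta>: "\<delta> \<in> {0<..1/2}" using \<epsilon> unfolding \<delta>_def by (simp add: min_less_iff_conj)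
  have "ed (Forb \<F>) p = q \<F> p" if p: "p \<in> {0<..<\<delta>}" for p
  proof (rule antisym)
    have p': "0 < p" "p < \<epsilon>" "p < 1/2" "p < 1 / (2 * N + 1)" using p by (auto simp: \<delta>_def)
    show "ed (Forb \<F>) p \<le> q \<F> p"
      unfolding q_def using exists_maximal_white[OF \<F>] p' ed_le_g[OF \<F>(1)]
      by (intro cINF_greatest) (auto simp: CRGs0_def)
    have "(MIN K\<in>\<K>. g K p) \<in> (\<lambda>K. g K p) ` \<K>" using \<K> by (intro Min_in) auto
    then obtain K where K: "K \<in> \<K>" "(MIN K\<in>\<K>. g K p) = g K p" by blast
    have "2 * p * card (crg_verts K) \<le> 2 * p * N"
      using N[OF K(1)] p'(1) by (intro mult_left_mono) auto
    also have "\<dots> \<le> p * (2 * N + 1)" using p'(1) by (simp add: algebra_simps)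
    also have "\<dots> \<le> 1" using p'(4) \<open>0 \<le> N\<close> by (simp add: pos_less_divide_eq)
    finally have "q \<F> p \<le> g K p"
      using K(1) \<K>(3) p' by (intro q_le_g_CRGs[OF \<F>(1,2)]) auto
    moreover have "ed (Forb \<F>) p = g K p" using ed K(2) p' by auto
    ultimately show "q \<F> p \<le> ed (Forb \<F>) p" by simp
  qed
  then show ?thesis using \<delta> by blast
qed

lemma q_eq_Min:
  assumes \<F>: "\<And>F. F \<in> \<F> \<Longrightarrow> is_graph F" "\<F> \<noteq> {}" "nontrivial_property (Forb \<F>)"
  shows "\<exists>R. finite R \<and> R \<noteq> {} \<and> R \<subseteq> CRGs \<F> \<and> (\<forall>p\<in>{0..1}. q \<F> p = (MIN K\<in>R. g K p))"
proof -
  define S where "S = {K \<in> CRGs0 \<F>. card (VW K) = family_chromatic_number \<F> - 1}"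
  obtain R where R: "R \<subseteq> S" "finite R" "\<And>K. K \<in> S \<Longrightarrow> \<exists>L\<in>R. \<forall>p\<in>{0..1}. g L p = g K p"
    using finite_representatives[OF \<F>(1,2)] unfolding S_def by blast
  have ne: "R \<noteq> {}" using exists_maximal_white[OF \<F>] R(3) unfolding S_def by blast
  have "q \<F> p = (MIN K\<in>R. g K p)" if p: "p \<in> {0..1}" for p
  proof -
    have "(\<lambda>K. g K p) ` S = (\<lambda>K. g K p) ` R"
    proof (rule antisym)
      show "(\<lambda>K. g K p) ` S \<subseteq> (\<lambda>K. g K p) ` R"
      proof (rule image_subsetI)
        fix K assume "K \<in> S"
        then obtain L where "L \<in> R" "g L p = g K p" using R(3) p by blast
        then show "g K p \<in> (\<lambda>K. g K p) ` R" by (metis imageI)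
      qed
    qed (rule image_mono[OF R(1)])
    then have "q \<F> p = Inf ((\<lambda>K. g K p) ` R)" unfolding q_def S_def[symmetric] by simp
    also have "\<dots> = (MIN K\<in>R. g K p)" using R(2) ne by (intro cInf_eq_Min) auto
    finally show ?thesis .
  qed
  moreover have "R \<subseteq> CRGs \<F>" using R(1) by (auto simp: S_def CRGs0_def)
  ultimately show ?thesis using R(2) ne by blast
qed

text \<open>At \<open>0\<close> the equality has to be obtained as a limit. If \<open>K\<close> realises the minimum at a small \<open>p > 0\<close>, then
  \<open>g K 0 \<le> g K p + p = ed (Forb \<F>) p + p \<le> ed (Forb \<F>) 0 + 2 p\<close>.\<close>

lemma regular_if_ed_eq_q:
  assumes \<F>: "\<And>F. F \<in> \<F> \<Longrightarrow> is_graph F" "\<F> \<noteq> {}" "nontrivial_property (Forb \<F>)"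
    and \<delta>: "\<delta> \<in> {0<..1/2}" and ed: "\<And>p. p \<in> {0<..<\<delta>} \<Longrightarrow> ed (Forb \<F>) p = q \<F> p"
  shows "regular_point \<F> 0"
proof -
  obtain R where R: "finite R" "R \<noteq> {}" "R \<subseteq> CRGs \<F>" "\<And>p. p \<in> {0..1} \<Longrightarrow> q \<F> p = (MIN K\<in>R. g K p)"
    using q_eq_Min[OF \<F>] by blast
  have ne: "CRGs \<F> \<noteq> {}" using R(2,3) by blast
  have "ed (Forb \<F>) 0 = (MIN K\<in>R. g K 0)"
  proof (rule antisym)
    show "ed (Forb \<F>) 0 \<le> (MIN K\<in>R. g K 0)"
      using R ed_le_g[OF \<F>(1), where p=0] by (subst Min_ge_iff) auto
    show "(MIN K\<in>R. g K 0) \<le> ed (Forb \<F>) 0"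
    proof (rule field_le_epsilon)
      fix t :: real assume t: "0 < t"
      define p where "p = min (\<delta> / 2) (t / 2)"
      have p: "0 < p" "p < \<delta>" "p \<le> 1" "2 * p \<le> t" using t \<delta> by (auto simp: p_def)
      have "(MIN K\<in>R. g K p) \<in> (\<lambda>K. g K p) ` R" using R by (intro Min_in) auto
      then obtain K where K: "K \<in> R" "(MIN K\<in>R. g K p) = g K p" by blast
      have "(MIN K\<in>R. g K 0) \<le> g K 0" using R(1) K(1) by (intro Min_le) auto
      also have "\<dots> \<le> g K p + p" using K(1) R(3) p by (intro g_0_le) (auto simp: CRGs_def)
      also have "g K p = ed (Forb \<F>) p" using ed[of p] R(4)[of p] K(2) p by simp
      also have "\<dots> \<le> ed (Forb \<F>) 0 + p" using p by (intro ed_le_ed_0 \<F>(1) ne) auto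
      finally show "(MIN K\<in>R. g K 0) \<le> ed (Forb \<F>) 0 + t" using p(4) by simp
    qed
  qed
  moreover have "ed (Forb \<F>) p = (MIN K\<in>R. g K p)" if "0 < p" "p < \<delta>" for p
    using ed[of p] R(4)[of p] that \<delta> by simp
  ultimately have "ed (Forb \<F>) p = (MIN K\<in>R. g K p)" if "p \<in> {0 - \<delta><..<0 + \<delta>} \<inter> {0..1}" for p
    using that by (cases "p = 0") auto
  then show ?thesis
    unfolding regular_point_def using \<delta> R(1-3) by (intro conjI exI[of _ \<delta>] exI[of _ R]) auto
qed

theorem theorem4p1:
  fixes \<F> :: "nat graph set"
  assumes "\<And>F. F \<in> \<F> \<Longrightarrow> is_graph F"
    and "\<F> \<noteq> {}"
    and "nontrivial_property (Forb \<F>)"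
  shows "regular_point \<F> 0 \<longleftrightarrow>
    (\<exists>\<delta>\<in>{0<..1/2}. \<forall>p\<in>{0<..<\<delta>}. ed (Forb \<F>) p = q \<F> p)"
  using ed_eq_q_if_regular[OF assms] regular_if_ed_eq_q[OF assms] by blast

end
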